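(* Let $(f_i)_{i=1}^\infty$ be a sequence of maps, each as in the setting below and each satisfying conditions (i) and (ii). Then the set of $x\in[0,1)$ such that for every $i\in\mathbb N$, every $m\in\mathbb N$ and every word $w$ of length $m$ over $\{0,\dots,g_{f_i}-1\}$, the sequence $\tau^{f_i}_w(x,n)/(n-m)$ does not converge as $n\to\infty$, has Hausdorff dimension $1$.
   Context: Setting: $f\colon[0,1)\to[0,1)$ and $g_f\ge 2$ is an integer such that $[0,1)$ is partitioned into $g_f$ half-open intervals $[a,b)$, enumerated as $[0],\dots,[g_f-1]$, such that on each of them $f$ is monotone and maps onto $[0,1)$, and $|f(x)-f(y)|\ge |x-y|$ for all $x,y$ in the same interval. For a word $x_1\dots x_n$ over $\{0,\dots,g_f-1\}$ the generation-$n$ cylinder is $C_{x_1\dots x_n}=\{x\in[0,1): f^{i-1}(x)\in[x_i],\ i=1,\dots,n\}$; $[0,1)$ is the generation-$0$ cylinder. It is assumed that $|C_{x_1\dots x_n}|\to 0$ as $n\to\infty$ for every $(x_i)\in\{0,\dots,g_f-1\}^{\mathbb N}$, so each $x\in[0,1)$ has a unique coding sequence $(x_i)_{i\ge1}$ (its $f$-expansion). Condition (i) (bounded distortion): there is $K_f>0$ such that for every cylinder $C_{x_1\dots x_n}$ (including $[0,1)$), $|(f^n)'(y)|/|(f^n)'(z)|<K_f$ for all $y,z\in C_{x_1\dots x_n}$; this implies $|C_{x_1\dots x_{n+1}}|/|C_{x_1\dots x_n}|>1/(g_fK_f)$ for all sequences and all $n$. Frequencies: for $m\in\mathbb N$ enumerate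 the $g_f^m$ words of length $m$ as $w_1,\dots,w_{g_f^m}$. For $x$ with $f$-expansion $(x_i)$ and $n>m$ let $\tau^f_w(x,n)=\#\{i\in\{1,\dots,n-m\}: x_i\dots x_{i+m-1}=w\}$. For $\bar p=(p_{w_1},\dots,p_{w_{g_f^m}})\in[0,1]^{g_f^m}$ with $\sum_j p_{w_j}=1$, let $G^{f,m}_{\bar p}=\{x: \tau^f_{w_j}(x,n)/(n-m)\to p_{w_j}\text{ as }n\to\infty\ \forall j\}$. Condition (ii): for each $m$ there is $\bar p$ with $\dim_H G^{f,m}_{\bar p}=1$, and for each word $w$ of length $m$ and each $\delta>0$ there is $\bar q$ with $q_w\ne p_w$ and $\dim_H G^{f,m}_{\bar q}>1-\delta$. *)

theory Defs
  imports "HOL-Analysis.Analysis"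
begin

definition hausdorff_pre :: "real \<Rightarrow> real \<Rightarrow> real set \<Rightarrow> ennreal" where
  "hausdorff_pre s \<delta> A =
     (INF U \<in> {U :: nat \<Rightarrow> real set. A \<subseteq> (\<Union>i. U i) \<and>
                 (\<forall>i. bounded (U i) \<and> diameter (U i) \<le> \<delta>)}.
        (\<Sum>i. ennreal (diameter (U i) powr s)))"

definition hausdorff_measure :: "real \<Rightarrow> real set \<Rightarrow> ennreal" where
  "hausdorff_measure s A = (SUP \<delta> \<in> {0<..}. hausdorff_pre s \<delta> A)"

text \<open>dim_H A = inf { s > 0 : H^s(A) = 0 } (equivalently inf over s >= 0, since H^s(A) = 0
  implies H^t(A) = 0 for t > s).\<close>

definition hausdorff_dim :: "real set \<Rightarrow> real" where
  "hausdorff_dim A = Inf {s. 0 < s \<and> hausdorff_measure s A = 0}"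

text \<open>The partition of [0,1) is given by breakpoints a 0 = 0 < a 1 < ... < a g = 1;
  the k-th interval (digit k, k < g) is [a k, a (k+1)).\<close>

definition pint :: "(nat \<Rightarrow> real) \<Rightarrow> nat \<Rightarrow> real set" where
  "pint a k = {a k..<a (Suc k)}"

definition digit :: "(nat \<Rightarrow> real) \<Rightarrow> nat \<Rightarrow> real \<Rightarrow> nat" where
  "digit a g y = (THE k. k < g \<and> y \<in> pint a k)"

text \<open>Coding sequence, 0-indexed: code f a g x j = x_(j+1) = digit of f^j(x).\<close>

definition code :: "(real \<Rightarrow> real) \<Rightarrow> (nat \<Rightarrow> real) \<Rightarrow> nat \<Rightarrow> real \<Rightarrow> nat \<Rightarrow> nat" where
  "code f a g x j = digit a g ((f ^^ j) x)"

definition words :: "nat \<Rightarrow> nat \<Rightarrow> nat list set" where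
  "words g m = {w. set w \<subseteq> {0..<g} \<and> length w = m}"

definition cyl :: "(real \<Rightarrow> real) \<Rightarrow> (nat \<Rightarrow> real) \<Rightarrow> nat \<Rightarrow> nat list \<Rightarrow> real set" where
  "cyl f a g w = {x \<in> {0..<1}. \<forall>i < length w. (f ^^ i) x \<in> pint a (w ! i)}"

text \<open>tau_w(x,n) = #{ i in {1..n-m} : x_i ... x_(i+m-1) = w }, with m = length w
  (written 0-indexed: j = i - 1).\<close>

definition tau :: "(real \<Rightarrow> real) \<Rightarrow> (nat \<Rightarrow> real) \<Rightarrow> nat \<Rightarrow> nat list \<Rightarrow> real \<Rightarrow> nat \<Rightarrow> nat" where
  "tau f a g w x n =
     card {j \<in> {0..<n - length w}. map (\<lambda>t. code f a g x (j + t)) [0..<length w] = w}"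

definition freq :: "(real \<Rightarrow> real) \<Rightarrow> (nat \<Rightarrow> real) \<Rightarrow> nat \<Rightarrow> nat list \<Rightarrow> real \<Rightarrow> nat \<Rightarrow> real" where
  "freq f a g w x n = real (tau f a g w x n) / real (n - length w)"

definition prob_vec :: "nat \<Rightarrow> nat \<Rightarrow> (nat list \<Rightarrow> real) \<Rightarrow> bool" where
  "prob_vec g m p \<longleftrightarrow> (\<forall>w \<in> words g m. 0 \<le> p w \<and> p w \<le> 1) \<and> (\<Sum>w \<in> words g m. p w) = 1"

definition Gset :: "(real \<Rightarrow> real) \<Rightarrow> (nat \<Rightarrow> real) \<Rightarrow> nat \<Rightarrow> nat \<Rightarrow> (nat list \<Rightarrow> real) \<Rightarrow> real set" where
  "Gset f a g m p = {x \<in> {0..<1}. \<forall>w \<in> words g m. freq f a g w x \<longlonglongrightarrow> p w}"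

definition setting :: "(real \<Rightarrow> real) \<Rightarrow> (nat \<Rightarrow> real) \<Rightarrow> nat \<Rightarrow> bool" where
  "setting f a g \<longleftrightarrow>
     2 \<le> g \<and> a 0 = 0 \<and> a g = 1 \<and> (\<forall>k < g. a k < a (Suc k)) \<and>
     f ` {0..<1} \<subseteq> {0..<1} \<and>
     (\<forall>k < g. f ` pint a k = {0..<1}) \<and>
     (\<forall>k < g. mono_on (pint a k) f \<or> monotone_on (pint a k) (\<le>) (\<ge>) f) \<and>
     (\<forall>k < g. \<forall>x \<in> pint a k. \<forall>y \<in> pint a k. \<bar>x - y\<bar> \<le> \<bar>f x - f y\<bar>) \<and>
     (\<forall>k < g. \<forall>x \<in> pint a k. f differentiable (at x within pint a k)) \<and>
     (\<forall>c :: nat \<Rightarrow> nat. (\<forall>j. c j < g) \<longrightarrow>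
        (\<lambda>n. diameter (cyl f a g (map c [0..<n]))) \<longlonglongrightarrow> 0)"

definition cond_i :: "(real \<Rightarrow> real) \<Rightarrow> (nat \<Rightarrow> real) \<Rightarrow> nat \<Rightarrow> bool" where
  "cond_i f a g \<longleftrightarrow>
     (\<exists>K > 0. \<forall>n. \<forall>w \<in> words g n. \<forall>y \<in> cyl f a g w. \<forall>z \<in> cyl f a g w. \<forall>Dy Dz.
        ((f ^^ n) has_real_derivative Dy) (at y within cyl f a g w) \<longrightarrow>
        ((f ^^ n) has_real_derivative Dz) (at z within cyl f a g w) \<longrightarrow>
        \<bar>Dy\<bar> / \<bar>Dz\<bar> < K)"

definition cond_ii :: "(real \<Rightarrow> real) \<Rightarrow> (nat \<Rightarrow> real) \<Rightarrow> nat \<Rightarrow> bool" where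
  "cond_ii f a g \<longleftrightarrow>
     (\<forall>m \<ge> 1. \<exists>p. prob_vec g m p \<and> hausdorff_dim (Gset f a g m p) = 1 \<and>
        (\<forall>w \<in> words g m. \<forall>\<delta> > 0. \<exists>q. prob_vec g m q \<and> q w \<noteq> p w \<and>
            hausdorff_dim (Gset f a g m q) > 1 - \<delta>))"

end

theory Submission
  imports Defs
begin

text \<open>A point at which, for every map \<open>i\<close> and word \<open>w\<close>, the frequency comes infinitely often
  arbitrarily close to two different values \<open>p w\<close> and \<open>q w\<close> has no convergent frequency. The set of
  these points is a countable intersection of sets
  \<open>U = {x. \<exists>n\<ge>N. \<bar>freq w x n - r\<bar> < \<epsilon>}\<close>, and by condition (ii) each \<open>U\<close> contains a set of dimension
  greater than \<open>t\<close>, for any \<open>t < 1\<close>. Pulling that set back into a cylinder comparable to a given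
  interval \<open>J\<close>, which by bounded distortion changes its \<open>t\<close>-dimensional content only by a constant
  factor, shows that \<open>U \<inter> J\<close> has content at least \<open>c |J| powr t\<close>, with \<open>c\<close> independent of \<open>J\<close>. As in
  Falconer's theory of sets with large intersections, a countable intersection of such sets still has
  dimension at least \<open>t\<close>: one builds a nested sequence of compact sets, the \<open>j\<close>-th one inside the
  \<open>j\<close>-th \<open>U\<close>, whose dyadic contents for slightly decreasing exponents all stay at least 1.\<close>

section \<open>Hausdorff content\<close>

text \<open>Unlike in \<open>hausdorff_pre\<close>, the covers carry no bound on the diameters, so
  the content rescales under Lipschitz maps without any change of a scale parameter. Boundedness is
  demanded because \<open>diameter\<close> is a real supremum and does not measure the size of an
  unbounded set.\<close>

definition hausdorff_content :: "real \<Rightarrow> real set \<Rightarrow> ennreal" where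
  "hausdorff_content t A = (INF U \<in> {U :: nat \<Rightarrow> real set. A \<subseteq> (\<Union>i. U i) \<and> (\<forall>i. bounded (U i))}.
     \<Sum>i. ennreal (diameter (U i) powr t))"

lemma hausdorff_content_le:
  assumes "A \<subseteq> (\<Union>i. U i)" "\<And>i. bounded (U i)"
  shows "hausdorff_content t A \<le> (\<Sum>i. ennreal (diameter (U i) powr t))"
  unfolding hausdorff_content_def by (rule INF_lower) (use assms in auto)

lemma hausdorff_content_cover:
  assumes "hausdorff_content t A < e"
  obtains U where "A \<subseteq> (\<Union>i. U i)" "\<And>i. bounded (U i)"
    "(\<Sum>i. ennreal (diameter (U i) powr t)) < e"
  using assms unfolding hausdorff_content_def by (auto simp: INF_less_iff)

lemma hausdorff_content_mono: "A \<subseteq> B \<Longrightarrow> hausdorff_content t A \<le> hausdorff_content t B"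
  unfolding hausdorff_content_def by (rule INF_superset_mono) auto

lemma hausdorff_content_bounded_le:
  assumes "bounded A"
  shows "hausdorff_content t A \<le> ennreal (diameter A powr t)"
proof -
  let ?U = "\<lambda>i::nat. if i = 0 then A else {}"
  have "hausdorff_content t A \<le> (\<Sum>i. ennreal (diameter (?U i) powr t))"
    by (rule hausdorff_content_le) (use assms in auto)
  also have "\<dots> = (\<Sum>i\<in>{0}. ennreal (diameter (?U i) powr t))"
    by (rule suminf_finite) auto
  finally show ?thesis by simp
qed

lemma hausdorff_content_UN_nat: "hausdorff_content t (\<Union>i. A i) \<le> (\<Sum>i. hausdorff_content t (A i))" for A :: "nat \<Rightarrow> real set"
proof (rule ennreal_le_epsilon)
  fix e :: real assume fin: "(\<Sum>i. hausdorff_content t (A i)) < top" and e: "0 < e"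
  have "hausdorff_content t (A i) < top" for i
    using fin by (meson ennreal_suminf_lessD)
  \<comment> \<open>A finite total makes each single content finite, so adding the slack e/2^(i+1)
    is a strict increase and near-optimal covers exist. They are merged below by the pairing
    \<open>prod_decode\<close>.\<close>
  then have "hausdorff_content t (A i) < hausdorff_content t (A i) + ennreal (e * (1/2)^Suc i)" for i
    using e by (simp add: less_top)
  then have "\<exists>U. A i \<subseteq> (\<Union>j. U j) \<and> (\<forall>j. bounded (U j)) \<and>
      (\<Sum>j. ennreal (diameter (U j) powr t)) \<le> hausdorff_content t (A i) + ennreal (e * (1/2)^Suc i)" for i
    by (metis hausdorff_content_cover less_imp_le)
  then obtain U where U: "\<And>i. A i \<subseteq> (\<Union>j. U i j)" "\<And>i j. bounded (U i j)"
      "\<And>i. (\<Sum>j. ennreal (diameter (U i j) powr t)) \<le> hausdorff_content t (A i) + ennreal (e * (1/2)^Suc i)"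
    by metis
  let ?V = "\<lambda>n. U (fst (prod_decode n)) (snd (prod_decode n))"
  have "(\<Union>i. A i) \<subseteq> (\<Union>n. ?V n)"
  proof
    fix x assume "x \<in> (\<Union>i. A i)"
    then obtain i j where "x \<in> U i j" using U(1) by blast
    then have "x \<in> ?V (prod_encode (i, j))" by simp
    then show "x \<in> (\<Union>n. ?V n)" by blast
  qed
  then have "hausdorff_content t (\<Union>i. A i) \<le> (\<Sum>n. ennreal (diameter (?V n) powr t))"
    by (rule hausdorff_content_le) (rule U(2))
  also have "\<dots> = (\<Sum>n. (\<lambda>(i, j). ennreal (diameter (U i j) powr t)) (prod_decode n))"
    by (simp add: case_prod_beta)
  also have "\<dots> = (\<Sum>i. \<Sum>j. ennreal (diameter (U i j) powr t))"
    by (rule suminf_ennreal_2dimen) simp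
  also have "\<dots> \<le> (\<Sum>i. hausdorff_content t (A i) + ennreal (e * (1/2)^Suc i))"
    by (intro suminf_le U(3)) auto
  also have "\<dots> = (\<Sum>i. hausdorff_content t (A i)) + (\<Sum>i. ennreal (e * (1/2)^Suc i))"
    by (rule suminf_add[symmetric]) auto
  also have "(\<Sum>i. ennreal (e * (1/2)^Suc i)) = ennreal e"
    using sums_mult[OF power_half_series, of e] e
    by (subst suminf_ennreal_eq) auto
  finally show "hausdorff_content t (\<Union>i. A i) \<le> (\<Sum>i. hausdorff_content t (A i)) + ennreal e" .
qed

lemma hausdorff_content_empty: "hausdorff_content t {} = 0"
  using hausdorff_content_bounded_le[of "{}" t] by simp

lemma hausdorff_content_UN_finite:
  assumes "finite I"
  shows "hausdorff_content t (\<Union>i\<in>I. A i) \<le> (\<Sum>i\<in>I. hausdorff_content t (A i))"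
  using assms
proof (induction I)
  case (insert k I)
  have eq: "(\<Union>i. (\<lambda>n::nat. if n = 0 then A k else if n = 1 then (\<Union>i\<in>I. A i) else {}) i)
      = (\<Union>i\<in>insert k I. A i)" 
    by (auto split: if_splits)
  have "hausdorff_content t (\<Union>i\<in>insert k I. A i) \<le>
    (\<Sum>n. hausdorff_content t (if n = 0 then A k else if n = (1::nat) then (\<Union>i\<in>I. A i) else {}))"
    using hausdorff_content_UN_nat[of t "\<lambda>n::nat. if n = 0 then A k else if n = 1 then (\<Union>i\<in>I. A i) else {}"]
    unfolding eq .
  also have "\<dots> = (\<Sum>n\<in>{0,1}. hausdorff_content t (if n = 0 then A k else if n = (1::nat) then (\<Union>i\<in>I. A i) else {}))"
    by (rule suminf_finite) (auto simp: hausdorff_content_empty)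
  also have "\<dots> = hausdorff_content t (A k) + hausdorff_content t (\<Union>i\<in>I. A i)" by simp
  also have "\<dots> \<le> hausdorff_content t (A k) + (\<Sum>i\<in>I. hausdorff_content t (A i))"
    using insert.IH by (rule add_left_mono)
  finally show ?case using insert.hyps by simp
qed (simp add: hausdorff_content_empty)

lemma hausdorff_content_lipschitz_image:
  assumes t: "0 < t" and L: "0 < L"
    and lip: "\<And>x y. x \<in> A \<Longrightarrow> y \<in> A \<Longrightarrow> dist (h x) (h y) \<le> L * dist x y"
  shows "hausdorff_content t (h ` A) \<le> ennreal (L powr t) * hausdorff_content t A"
proof -
  have "hausdorff_content t (h ` A) \<le> ennreal (L powr t) * (\<Sum>i. ennreal (diameter (U i) powr t))"
    if U: "A \<subseteq> (\<Union>i. U i)" "\<forall>i. bounded (U i)" for U :: "nat \<Rightarrow> real set"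
  proof -
    have d: "bounded (h ` (A \<inter> U i)) \<and> diameter (h ` (A \<inter> U i)) \<le> L * diameter (U i)" for i
    proof -
      have b: "dist x y \<le> L * diameter (U i)" if im: "x \<in> h ` (A \<inter> U i)" "y \<in> h ` (A \<inter> U i)" for x y
      proof -
        obtain x' y' where xy: "x = h x'" "y = h y'" "x' \<in> A \<inter> U i" "y' \<in> A \<inter> U i"
          using im by blast
        have "dist x y \<le> L * dist x' y'" using lip xy by auto
        also have "\<dots> \<le> L * diameter (U i)"
          using L U(2) xy by (intro mult_left_mono diameter_bounded_bound) auto
        finally show ?thesis .
      qed
      have "bounded (h ` (A \<inter> U i))"
        unfolding bounded_two_points using b by blast
      moreover have "diameter (h ` (A \<inter> U i)) \<le> L * diameter (U i)"
        using b L U(2) diameter_ge_0[of "U i"] by (intro diameter_le) (auto simp: dist_norm)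
      ultimately show ?thesis by simp
    qed
    have "hausdorff_content t (h ` A) \<le> (\<Sum>i. ennreal (diameter (h ` (A \<inter> U i)) powr t))"
      using U(1) by (intro hausdorff_content_le) (use d in \<open>auto simp flip: image_UN Int_UN_distrib\<close>)
    also have "\<dots> \<le> (\<Sum>i. ennreal (L powr t) * ennreal (diameter (U i) powr t))"
    proof (rule suminf_le)
      fix i
      have "diameter (h ` (A \<inter> U i)) powr t \<le> (L * diameter (U i)) powr t"
        using d[of i] t by (intro powr_mono2) (auto intro: diameter_ge_0)
      also have "\<dots> = L powr t * diameter (U i) powr t"
        using U(2) L by (intro powr_mult)
      finally show "ennreal (diameter (h ` (A \<inter> U i)) powr t)
          \<le> ennreal (L powr t) * ennreal (diameter (U i) powr t)"
        by (simp add: ennreal_mult[symmetric] ennreal_leI)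
    qed auto
    finally show ?thesis by (simp add: ennreal_suminf_cmult)
  qed
  \<comment> \<open>After division by the constant, the bound for each single cover passes to the
    infimum over all covers.\<close>
  then have "hausdorff_content t (h ` A) / ennreal (L powr t) \<le> hausdorff_content t A"
    unfolding hausdorff_content_def[of t A] using L
    by (intro INF_greatest divide_le_posI_ennreal) auto
  then have "hausdorff_content t (h ` A) / ennreal (L powr t) * ennreal (L powr t) \<le> hausdorff_content t A * ennreal (L powr t)"
    by (rule mult_right_mono) simp
  then show ?thesis using L
    by (subst (asm) ennreal_divide_times) (simp add: mult.commute)
qed

text \<open>In a cover whose total is below \<open>\<delta> powr t\<close>, each single term is
  below it too, so every diameter is automatically at most \<delta>. Thus vanishing content already
  yields arbitrarily cheap covers at every scale.\<close>

lemma hausdorff_measure_eq_0I: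
  assumes t: "0 < t" and 0: "hausdorff_content t A = 0"
  shows "hausdorff_measure t A = 0"
proof -
  have "hausdorff_pre t \<delta> A \<le> 0 + ennreal e" if "0 < \<delta>" "0 < e" for \<delta> e
  proof -
    have "hausdorff_content t A < ennreal (min e (\<delta> powr t))" using 0 that by auto
    then obtain U where U: "A \<subseteq> (\<Union>i. U i)" "\<And>i. bounded (U i)"
      and S: "(\<Sum>i. ennreal (diameter (U i) powr t)) < ennreal (min e (\<delta> powr t))"
      by (rule hausdorff_content_cover) blast
    have "diameter (U i) \<le> \<delta>" for i
    proof -
      have "ennreal (diameter (U i) powr t) < ennreal (\<delta> powr t)"
        using ennreal_suminf_lessD[OF S, of i] by (auto simp: ennreal_less_iff)
      then have "diameter (U i) powr t < \<delta> powr t" by (simp add: ennreal_less_iff)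
      then show ?thesis using t that
        by (smt (verit) powr_mono2)
    qed
    then have "hausdorff_pre t \<delta> A \<le> (\<Sum>i. ennreal (diameter (U i) powr t))"
      unfolding hausdorff_pre_def by (intro INF_lower) (use U in auto)
    also have "\<dots> \<le> ennreal e" using S
      by (metis ennreal_leI less_imp_le min.cobounded1 order_trans)
    finally show ?thesis by simp
  qed
  then have "hausdorff_pre t \<delta> A \<le> 0" if "0 < \<delta>" for \<delta>
    by (rule ennreal_le_epsilon) (simp only: that)
  then show ?thesis unfolding hausdorff_measure_def
    by (intro antisym SUP_least) auto
qed

text \<open>This turns the dimension bounds of condition (ii) into positive content.\<close>

lemma hausdorff_content_pos_of_dim:
  assumes "0 < t" "t < hausdorff_dim A"
  shows "0 < hausdorff_content t A"
proof (rule ccontr)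
  assume "\<not> 0 < hausdorff_content t A"
  then have "hausdorff_measure t A = 0" using assms(1) by (intro hausdorff_measure_eq_0I) auto
  then have "hausdorff_dim A \<le> t"
    unfolding hausdorff_dim_def using assms(1)
    by (intro cInf_lower) (auto intro!: bdd_belowI[of _ 0])
  then show False using assms(2) by simp
qed

text \<open>Cutting the unit interval into n pieces of length 1/n costs n^(1-s), which tends to 0.
  This gives the upper bound 1 for the dimension.\<close>

lemma hausdorff_measure_unit_eq_0:
  assumes "1 < s" "A \<subseteq> {0..<1}"
  shows "hausdorff_measure s A = 0"
proof (rule hausdorff_measure_eq_0I)
  show "0 < s" using assms by simp
  have le: "hausdorff_content s A \<le> ennreal (real n powr (1 - s))" if n: "0 < n" for n :: nat
  proof -
    let ?I = "\<lambda>k::nat. {real k / n .. (real k + 1) / n}"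
    have "A \<subseteq> (\<Union>k\<in>{..<n}. ?I k)"
    proof
      fix x assume "x \<in> A"
      then have x: "0 \<le> x" "x < 1" using assms by auto
      define k where "k = nat \<lfloor>x * n\<rfloor>"
      have k: "real k = of_int \<lfloor>x * n\<rfloor>" unfolding k_def using x by simp
      have "real k \<le> x * n" "x * n < real k + 1" unfolding k by linarith+
      moreover have "x * n < n" using x n by simp
      ultimately have "real k < n" "x \<in> ?I k" using n by (linarith, simp add: field_simps)
      then have "k < n" "x \<in> ?I k" by simp_all
      then show "x \<in> (\<Union>k\<in>{..<n}. ?I k)" by blast
    qed
    then have "hausdorff_content s A \<le> hausdorff_content s (\<Union>k\<in>{..<n}. ?I k)" by (rule hausdorff_content_mono)
    also have "\<dots> \<le> (\<Sum>k<n. hausdorff_content s (?I k))" by (rule hausdorff_content_UN_finite) simp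
    also have "\<dots> \<le> (\<Sum>k<n. ennreal ((1 / n) powr s))"
    proof (rule sum_mono)
      fix k
      have "diameter (?I k) = 1 / n"
        using n by (subst diameter_closed_interval) (auto simp: field_simps)
      then show "hausdorff_content s (?I k) \<le> ennreal ((1 / n) powr s)"
        using hausdorff_content_bounded_le[of "?I k" s] by simp
    qed
    also have "\<dots> = ennreal (n * (1 / n) powr s)"
      by (simp add: ennreal_mult ennreal_of_nat_eq_real_of_nat)
    also have "n * (1 / n) powr s = real n powr (1 - s)"
      using n by (simp add: powr_diff powr_divide)
    finally show ?thesis .
  qed
  have "((\<lambda>n. real n powr (1 - s)) \<longlongrightarrow> 0) sequentially"
    using assms(1) by (intro tendsto_neg_powr filterlim_real_sequentially) simp
  then have "((\<lambda>n. ennreal (real n powr (1 - s))) \<longlongrightarrow> ennreal 0) sequentially"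
    by (rule tendsto_ennrealI)
  moreover have "\<forall>\<^sub>F n in sequentially. hausdorff_content s A \<le> ennreal (real n powr (1 - s))"
    using eventually_gt_at_top[of 0] by (rule eventually_mono) (rule le)
  ultimately have "hausdorff_content s A \<le> ennreal 0"
    by (rule tendsto_lowerbound) simp
  then show "hausdorff_content s A = 0" by simp
qed

lemma hausdorff_content_pos_UN_nat:
  fixes A :: "nat \<Rightarrow> real set"
  assumes "0 < hausdorff_content t (\<Union>i. A i)"
  obtains i where "0 < hausdorff_content t (A i)"
proof -
  have "\<exists>i. hausdorff_content t (A i) \<noteq> 0"
  proof (rule ccontr)
    assume "\<nexists>i. hausdorff_content t (A i) \<noteq> 0"
    then show False using hausdorff_content_UN_nat[of t A] assms by simp
  qed
  then show thesis using that by (auto simp: zero_less_iff_neq_zero)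
qed

lemma hausdorff_content_atLeastAtMost_le:
  assumes "0 \<le> d"
  shows "hausdorff_content t {x..x + d} \<le> ennreal (d powr t)"
  using hausdorff_content_bounded_le[of "{x..x + d}" t] assms by simp

lemma hausdorff_measure_mono:
  assumes "A \<subseteq> B"
  shows "hausdorff_measure s A \<le> hausdorff_measure s B"
  unfolding hausdorff_measure_def hausdorff_pre_def
  by (intro SUP_mono' INF_superset_mono order_refl) (use assms in auto)

section \<open>Dyadic contents and large intersections\<close>

definition dyadic :: "nat \<times> nat \<Rightarrow> real set" where
  "dyadic b = {real (snd b) / 2 ^ fst b ..< (real (snd b) + 1) / 2 ^ fst b}"

definition weight :: "real \<Rightarrow> nat \<times> nat \<Rightarrow> real" where
  "weight s b = (1 / 2 ^ fst b) powr s"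

definition dyadic_union :: "nat \<Rightarrow> nat set \<Rightarrow> real set" where
  "dyadic_union n S = (\<Union>l\<in>S. dyadic (n, l))"

text \<open>A lower bound for the dyadic net content, \<open>weight s b\<close> being the s-th power
  of the length of \<open>dyadic b\<close>. Finite covers are enough because compactness will
  provide a finite subcover when the bound is applied.\<close>

definition dyadic_content_ge :: "real \<Rightarrow> real \<Rightarrow> real set \<Rightarrow> bool" where
  "dyadic_content_ge s \<kappa> A \<longleftrightarrow> (\<forall>B. finite B \<longrightarrow> A \<subseteq> (\<Union>b\<in>B. dyadic b) \<longrightarrow> \<kappa> \<le> (\<Sum>b\<in>B. weight s b))"

text \<open>A uniform large-intersection property: the constant \<open>c\<close> is the same for all
  dyadic intervals J in the unit interval. Asking for all large \<open>m\<close>, not just one, lets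
  finitely many J be refined at a common level. Closures are placed in \<open>U\<close> so that
  limits of nested constructions stay in \<open>U\<close>.\<close>

definition ubiquitous :: "real \<Rightarrow> real set \<Rightarrow> bool" where
  "ubiquitous t U \<longleftrightarrow> (\<exists>c>0. \<forall>n. \<forall>k<2 ^ n. \<forall>\<^sub>F m in sequentially. \<exists>S\<subseteq>{..<2 ^ m}.
     (\<forall>l\<in>S. closure (dyadic (m, l)) \<subseteq> U) \<and> dyadic_union m S \<subseteq> dyadic (n, k) \<and>
     dyadic_content_ge t (c * weight t (n, k)) (dyadic_union m S))"

section \<open>Arithmetic and nesting of dyadic intervals\<close>

lemma dyadic_iff: "x \<in> dyadic (n, k) \<longleftrightarrow> \<lfloor>x * 2 ^ n\<rfloor> = int k"
  by (auto simp: dyadic_def floor_eq_iff field_simps)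

lemma dyadic_nonempty: "dyadic b \<noteq> {}"
  by (auto simp: dyadic_def divide_strict_right_mono)

lemma dyadic_unique: "x \<in> dyadic (n, k) \<Longrightarrow> x \<in> dyadic (n, l) \<Longrightarrow> k = l"
  by (simp add: dyadic_iff)

lemma dyadic_parent:
  assumes "n \<le> n'" "x \<in> dyadic (n', l)"
  shows "x \<in> dyadic (n, l div 2 ^ (n' - n))"
proof -
  have "(2 :: real) ^ n' = 2 ^ n * 2 ^ (n' - n)"
    using assms(1) by (simp flip: power_add)
  then have "x * 2 ^ n = x * 2 ^ n' / real_of_int (2 ^ (n' - n))" by simp
  then have "\<lfloor>x * 2 ^ n\<rfloor> = \<lfloor>x * 2 ^ n'\<rfloor> div 2 ^ (n' - n)"
    using floor_divide_real_eq_div[of "2 ^ (n' - n)" "x * 2 ^ n'"] by simp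
  then show ?thesis using assms(2) by (simp add: dyadic_iff zdiv_int)
qed

lemma dyadic_nested:
  assumes "n \<le> n'"
  shows "dyadic (n', l) \<subseteq> dyadic (n, k) \<or> dyadic (n', l) \<inter> dyadic (n, k) = {}"
  using dyadic_parent[OF assms] dyadic_unique by blast

lemma dyadic_union_refine:
  assumes "S \<subseteq> {..<2 ^ n}" "n \<le> n'"
  obtains S' where "S' \<subseteq> {..<2 ^ n'}" "dyadic_union n' S' = dyadic_union n S"
proof
  define S' where "S' = {l. l div 2 ^ (n' - n) \<in> S}"
  show "S' \<subseteq> {..<2 ^ n'}"
  proof
    fix l assume "l \<in> S'"
    then have "l div 2 ^ (n' - n) < 2 ^ n" using assms(1) by (auto simp: S'_def)
    then have "l < 2 ^ n * 2 ^ (n' - n)" by (simp add: div_less_iff_less_mult)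
    then show "l \<in> {..<2 ^ n'}" using assms(2) by (simp add: power_add[symmetric])
  qed
  show "dyadic_union n' S' = dyadic_union n S"
  proof
    show "dyadic_union n' S' \<subseteq> dyadic_union n S"
      using dyadic_parent[OF assms(2)] by (auto simp: dyadic_union_def S'_def)
    show "dyadic_union n S \<subseteq> dyadic_union n' S'"
    proof
      fix x assume "x \<in> dyadic_union n S"
      then obtain k where k: "k \<in> S" "x \<in> dyadic (n, k)" by (auto simp: dyadic_union_def)
      then have "0 \<le> x" by (auto simp: dyadic_def intro: order_trans[rotated])
      then have x: "x \<in> dyadic (n', nat \<lfloor>x * 2 ^ n'\<rfloor>)" by (simp add: dyadic_iff)
      then have "nat \<lfloor>x * 2 ^ n'\<rfloor> div 2 ^ (n' - n) = k"
        using dyadic_parent[OF assms(2)] k(2) dyadic_unique by blast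
      then show "x \<in> dyadic_union n' S'" using x k(1) by (auto simp: dyadic_union_def S'_def)
    qed
  qed
qed

lemma dyadic_union_subset_unit:
  assumes "S \<subseteq> {..<2 ^ n}"
  shows "dyadic_union n S \<subseteq> {0..<1}"
proof
  fix x assume "x \<in> dyadic_union n S"
  then obtain k where k: "k < 2 ^ n" "x \<in> dyadic (n, k)" using assms by (auto simp: dyadic_union_def)
  then have "real k + 1 \<le> 2 ^ n" using of_nat_mono[of "Suc k" "2 ^ n", where 'a = real] by simp
  then have "(real k + 1) / 2 ^ n \<le> 1" by simp
  moreover have "0 \<le> real k / 2 ^ n" by simp
  moreover have "real k / 2 ^ n \<le> x" "x < (real k + 1) / 2 ^ n" using k(2) by (auto simp: dyadic_def)
  ultimately show "x \<in> {0..<1}" by (meson atLeastLessThan_iff less_le_trans order_trans)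
qed

lemma weight_nonneg [simp]: "0 \<le> weight s b"
  by (simp add: weight_def)

lemma weight_add: "weight (s + t) b = weight s b * weight t b"
  by (simp add: weight_def powr_add)

lemma weight_antimono: "s \<le> t \<Longrightarrow> weight t b \<le> weight s b"
  unfolding weight_def by (intro powr_mono') auto

lemma weight_level_antimono: "0 \<le> s \<Longrightarrow> fst b \<le> fst b' \<Longrightarrow> weight s b' \<le> weight s b"
  unfolding weight_def by (intro powr_mono2 divide_left_mono) (auto intro: power_increasing)

lemma dyadic_content_ge_antimono: "dyadic_content_ge t \<kappa> A \<Longrightarrow> s \<le> t \<Longrightarrow> dyadic_content_ge s \<kappa> A"
  unfolding dyadic_content_ge_def by (meson order_trans sum_mono weight_antimono)

text \<open>The start of the nested construction. By Lebesgue measure the lengths in a cover sum to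
  at least 1, and a length at most 1 does not exceed its s-th power for s at most 1.\<close>

lemma dyadic_content_ge_unit:
  assumes "s \<le> 1"
  shows "dyadic_content_ge s 1 (dyadic_union 0 {0})"
  unfolding dyadic_content_ge_def
proof (intro allI impI)
  fix B assume fin: "finite B" and cov: "dyadic_union 0 {0} \<subseteq> (\<Union>b\<in>B. dyadic b)"
  have "ennreal 1 = emeasure lborel {0..<1::real}" by simp
  also have "{0..<1::real} = dyadic_union 0 {0}" by (simp add: dyadic_union_def dyadic_def)
  also have "emeasure lborel (dyadic_union 0 {0}) \<le> emeasure lborel (\<Union>b\<in>B. dyadic b)"
    using fin by (intro emeasure_mono cov) (auto simp: dyadic_def)
  also have "\<dots> \<le> (\<Sum>b\<in>B. emeasure lborel (dyadic b))"
    using fin by (intro emeasure_subadditive_finite) (auto simp: dyadic_def)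
  also have "\<dots> = (\<Sum>b\<in>B. ennreal (weight 1 b))"
  proof (rule sum.cong[OF refl])
    fix b
    have "(real (snd b) + 1) / 2 ^ fst b = real (snd b) / 2 ^ fst b + 1 / 2 ^ fst b"
      by (simp add: add_divide_distrib)
    then show "emeasure lborel (dyadic b) = ennreal (weight 1 b)"
      by (simp add: dyadic_def weight_def)
  qed
  also have "\<dots> = ennreal (\<Sum>b\<in>B. weight 1 b)" by (simp add: sum_ennreal)
  finally have "1 \<le> (\<Sum>b\<in>B. weight 1 b)"
    by (subst (asm) ennreal_le_iff) (auto intro: sum_nonneg)
  also have "\<dots> \<le> (\<Sum>b\<in>B. weight s b)" using assms by (intro sum_mono weight_antimono)
  finally show "1 \<le> (\<Sum>b\<in>B. weight s b)" .
qed

lemma tendsto_half_power_powr: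
  assumes "0 < t"
  shows "(\<lambda>m. (1 / 2 ^ m :: real) powr t) \<longlonglongrightarrow> 0"
proof -
  have "((\<lambda>j. (1 / 2 :: real) ^ j) \<longlongrightarrow> 0) sequentially" by (rule LIMSEQ_realpow_zero) auto
  then have "((\<lambda>j. ((1 / 2 :: real) ^ j) powr t) \<longlongrightarrow> 0 powr t) sequentially"
    using assms by (intro tendsto_powr') auto
  then show ?thesis using assms by (simp add: power_divide)
qed

text \<open>The constant \<open>c\<close> of \<open>ubiquitous\<close> is absorbed by lowering the exponent:
  \<open>|J| powr (s' - s) < c\<close> once the intervals \<open>J\<close> that are refined are short.\<close>

lemma ubiquitous_refine:
  assumes U: "ubiquitous t U" and s: "s < s'" "s' \<le> t"
    and S: "S \<subseteq> {..<2 ^ n}" and K: "dyadic_content_ge s' 1 (dyadic_union n S)"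
  obtains m S' where "S' \<subseteq> {..<2 ^ m}" "dyadic_union m S' \<subseteq> dyadic_union n S"
    "closure (dyadic_union m S') \<subseteq> U" "dyadic_content_ge s 1 (dyadic_union m S')"
proof -
  obtain c where c: "0 < c" and Uc: "\<And>n k. k < 2 ^ n \<Longrightarrow> \<forall>\<^sub>F m in sequentially. \<exists>S\<subseteq>{..<2 ^ m}.
     (\<forall>l\<in>S. closure (dyadic (m, l)) \<subseteq> U) \<and> dyadic_union m S \<subseteq> dyadic (n, k) \<and>
     dyadic_content_ge t (c * weight t (n, k)) (dyadic_union m S)"
    using U unfolding ubiquitous_def by blast
  have "(\<lambda>j. (1 / 2 ^ j :: real) powr (s' - s)) \<longlonglongrightarrow> 0"
    using s by (intro tendsto_half_power_powr) simp
  then have "\<forall>\<^sub>F j in sequentially. (1 / 2 ^ j :: real) powr (s' - s) < c"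
    using c by (rule order_tendstoD)
  then have "\<forall>\<^sub>F j in sequentially. (1 / 2 ^ j :: real) powr (s' - s) < c \<and> n \<le> j"
    using eventually_ge_at_top by (rule eventually_conj)
  then obtain n' where n': "(1 / 2 ^ n' :: real) powr (s' - s) < c" "n \<le> n'"
    by (auto dest: eventually_happens'[rotated])
  obtain S1 where S1: "S1 \<subseteq> {..<2 ^ n'}" "dyadic_union n' S1 = dyadic_union n S"
    using dyadic_union_refine[OF S n'(2)] .
  have finS1: "finite S1" using S1(1) finite_subset by blast
  \<comment> \<open>Finitely many intervals are to be refined, so a single level \<open>m\<close>
    serves all of them.\<close>
  have "\<forall>\<^sub>F m in sequentially. \<forall>k\<in>S1. \<exists>T\<subseteq>{..<2 ^ m}.
     (\<forall>l\<in>T. closure (dyadic (m, l)) \<subseteq> U) \<and> dyadic_union m T \<subseteq> dyadic (n', k) \<and>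
     dyadic_content_ge t (c * weight t (n', k)) (dyadic_union m T)"
    using S1(1) by (intro eventually_ball_finite[OF finS1] ballI Uc) auto
  then obtain m where "\<forall>k\<in>S1. \<exists>T\<subseteq>{..<2 ^ m}.
     (\<forall>l\<in>T. closure (dyadic (m, l)) \<subseteq> U) \<and> dyadic_union m T \<subseteq> dyadic (n', k) \<and>
     dyadic_content_ge t (c * weight t (n', k)) (dyadic_union m T)"
    by (auto dest: eventually_happens'[rotated])
  then obtain T where T: "\<And>k. k \<in> S1 \<Longrightarrow> T k \<subseteq> {..<2 ^ m}"
    "\<And>k l. k \<in> S1 \<Longrightarrow> l \<in> T k \<Longrightarrow> closure (dyadic (m, l)) \<subseteq> U"
    "\<And>k. k \<in> S1 \<Longrightarrow> dyadic_union m (T k) \<subseteq> dyadic (n', k)"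
    "\<And>k. k \<in> S1 \<Longrightarrow> dyadic_content_ge t (c * weight t (n', k)) (dyadic_union m (T k))"
    by metis
  define S' where "S' = (\<Union>k\<in>S1. T k)"
  have eq: "dyadic_union m S' = (\<Union>k\<in>S1. dyadic_union m (T k))" by (auto simp: dyadic_union_def S'_def)
  have sub: "S' \<subseteq> {..<2 ^ m}" using T(1) by (auto simp: S'_def)
  show thesis
  proof
    show "S' \<subseteq> {..<2 ^ m}" by fact
    show "dyadic_union m S' \<subseteq> dyadic_union n S"
      unfolding eq S1(2)[symmetric] using T(3) by (auto simp: dyadic_union_def[of n'])
    have "finite S'" using sub finite_subset by blast
    then have "closure (dyadic_union m S') \<subseteq> (\<Union>l\<in>S'. closure (dyadic (m, l)))"
      unfolding dyadic_union_def using closure_subset by (intro closure_minimal closed_UN) fastforce+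
    then show "closure (dyadic_union m S') \<subseteq> U" using T(2) by (auto simp: S'_def)
    show "dyadic_content_ge s 1 (dyadic_union m S')"
      unfolding dyadic_content_ge_def
    proof (intro allI impI)
      fix B assume fin: "finite B" and cov: "dyadic_union m S' \<subseteq> (\<Union>b\<in>B. dyadic b)"
      \<comment> \<open>The cover is sorted against level \<open>n'\<close>: \<open>B1\<close> holds
        its coarse members, \<open>L\<close> the intervals of the old set that no coarse member
        swallows, and \<open>C l\<close> the strictly finer members inside the interval
        \<open>l\<close>.\<close>
      define B1 where "B1 = {b \<in> B. fst b \<le> n'}"
      define L where "L = {l \<in> S1. \<forall>b\<in>B1. \<not> dyadic (n', l) \<subseteq> dyadic b}"
      define C where "C l = {b \<in> B. n' < fst b \<and> dyadic b \<subseteq> dyadic (n', l)}" for l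
      have finL: "finite L" using finS1 by (simp add: L_def)
      have finC: "finite (C l)" for l using fin by (simp add: C_def)
      \<comment> \<open>An interval J in \<open>L\<close> has its refined part covered by
        \<open>C l\<close> alone, which gives t-content at least c |J|^t. The members b of
        \<open>C l\<close> are shorter than J, so |b|^t is at most |J|^(t-s) |b|^s, and the bound
        becomes c |J|^s for exponent s. This dominates |J|^s' by the choice of
        \<open>n'\<close>.\<close>
      have key: "weight s' (n', l) \<le> (\<Sum>b\<in>C l. weight s b)" if l: "l \<in> L" for l
      proof -
        have lS: "l \<in> S1" using l by (simp add: L_def)
        have "dyadic_union m (T l) \<subseteq> (\<Union>b\<in>C l. dyadic b)"
        proof
          fix x assume x: "x \<in> dyadic_union m (T l)"
          then have "x \<in> dyadic_union m S'" using lS by (auto simp: eq)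
          then obtain b where b: "b \<in> B" "x \<in> dyadic b" using cov by blast
          have xl: "x \<in> dyadic (n', l)" using x T(3)[OF lS] by blast
          show "x \<in> (\<Union>b\<in>C l. dyadic b)"
          proof (cases "fst b \<le> n'")
            case True
            then have "dyadic (n', l) \<subseteq> dyadic b"
              using dyadic_nested[of "fst b" n' l "snd b"] xl b(2) by auto
            then show ?thesis using l b(1) True unfolding L_def B1_def by blast
          next
            case False
            then have "dyadic b \<subseteq> dyadic (n', l)"
              using dyadic_nested[of n' "fst b" "snd b" l] xl b(2) by auto
            then show ?thesis using False b by (intro UN_I[of b]) (simp_all add: C_def)
          qed
        qed
        then have "c * weight t (n', l) \<le> (\<Sum>b\<in>C l. weight t b)"
          using T(4)[OF lS] finC by (auto simp: dyadic_content_ge_def)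
        also have "\<dots> \<le> (\<Sum>b\<in>C l. weight (t - s) (n', l) * weight s b)"
        proof (rule sum_mono)
          fix b assume "b \<in> C l"
          then have "weight (t - s) b \<le> weight (t - s) (n', l)"
            using s by (intro weight_level_antimono) (auto simp: C_def)
          then show "weight t b \<le> weight (t - s) (n', l) * weight s b"
            using weight_add[of "t - s" s b] by (simp add: mult_right_mono)
        qed
        also have "\<dots> = weight (t - s) (n', l) * (\<Sum>b\<in>C l. weight s b)" by (simp add: sum_distrib_left)
        finally have "weight (t - s) (n', l) * (c * weight s (n', l)) \<le> weight (t - s) (n', l) * (\<Sum>b\<in>C l. weight s b)"
          using weight_add[of "t - s" s "(n', l)"] by (simp add: mult.left_commute)
        then have "c * weight s (n', l) \<le> (\<Sum>b\<in>C l. weight s b)"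
          by (rule mult_left_le_imp_le) (simp add: weight_def)
        moreover have "weight s' (n', l) \<le> c * weight s (n', l)"
          using weight_add[of "s' - s" s "(n', l)"] n'(1) by (simp add: weight_def mult_right_mono)
        ultimately show ?thesis by simp
      qed
      \<comment> \<open>Replacing the fine members inside each J of \<open>L\<close> by J itself
        gives a cover of the old set, to which the hypothesis for \<open>s'\<close> applies. By
        \<open>key\<close> the replacement does not undercount: the s'-weights of the new cover sum
        to at most the s-weights of \<open>B\<close>.\<close>
      have "dyadic_union n S \<subseteq> (\<Union>b\<in>B1 \<union> Pair n' ` L. dyadic b)"
        unfolding S1(2)[symmetric] by (fastforce simp: dyadic_union_def L_def)
      then have "1 \<le> (\<Sum>b\<in>B1 \<union> Pair n' ` L. weight s' b)"
        using K fin finL by (auto simp: dyadic_content_ge_def B1_def)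
      also have "\<dots> \<le> (\<Sum>b\<in>B1. weight s' b) + (\<Sum>b\<in>Pair n' ` L. weight s' b)"
        using fin finL by (subst sum_Un) (auto simp: B1_def intro: sum_nonneg)
      also have "(\<Sum>b\<in>Pair n' ` L. weight s' b) = (\<Sum>l\<in>L. weight s' (n', l))"
        by (subst sum.reindex) (auto simp: inj_on_def)
      also have "\<dots> \<le> (\<Sum>l\<in>L. \<Sum>b\<in>C l. weight s b)" by (rule sum_mono) (rule key)
      also have "\<dots> = (\<Sum>b\<in>(\<Union>l\<in>L. C l). weight s b)"
      proof (rule sum.UNION_disjoint[symmetric])
        \<comment> \<open>A fine member is nonempty and lies in only one interval of level
          \<open>n'\<close>, so no weight is counted twice.\<close>
        show "\<forall>l\<in>L. \<forall>l'\<in>L. l \<noteq> l' \<longrightarrow> C l \<inter> C l' = {}"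
        proof (intro ballI impI, rule ccontr)
          fix l l' assume "l \<noteq> l'" "C l \<inter> C l' \<noteq> {}"
          then obtain b where "dyadic b \<subseteq> dyadic (n', l)" "dyadic b \<subseteq> dyadic (n', l')" by (auto simp: C_def)
          then show False using dyadic_nonempty[of b] dyadic_unique \<open>l \<noteq> l'\<close> by blast
        qed
      qed (use finL finC in auto)
      also have "(\<Sum>b\<in>B1. weight s' b) \<le> (\<Sum>b\<in>B1. weight s b)" using s by (intro sum_mono weight_antimono) simp
      also have "(\<Sum>b\<in>B1. weight s b) + (\<Sum>b\<in>(\<Union>l\<in>L. C l). weight s b) = (\<Sum>b\<in>B1 \<union> (\<Union>l\<in>L. C l). weight s b)"
        using fin finL finC by (intro sum.union_disjoint[symmetric]) (auto simp: B1_def C_def)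
      also have "\<dots> \<le> (\<Sum>b\<in>B. weight s b)"
        using fin by (intro sum_mono2) (auto simp: B1_def C_def)
      finally show "1 \<le> (\<Sum>b\<in>B. weight s b)" by simp
    qed
  qed
qed

text \<open>At the level n with r \<le> 2^-n \<le> 2r the ball meets at most three dyadic intervals,
  and 3 (2r)^s \<le> 6 r^s because s \<le> 1. The restriction to \<open>{0..}\<close> reflects that
  dyadic intervals have natural indices.\<close>

lemma ball_dyadic_cover:
  assumes s: "0 < s" "s \<le> 1" and r: "0 < r" "r < 1"
  obtains B where "finite B" "ball x r \<inter> {0..} \<subseteq> (\<Union>b\<in>B. dyadic b)" "(\<Sum>b\<in>B. weight s b) \<le> 6 * r powr s"
proof -
  define m where "m = (LEAST m. (1 / 2 :: real) ^ m < r)"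
  have m: "(1 / 2) ^ m < r"
    unfolding m_def using real_arch_pow_inv[OF r(1), of "1/2"] by (auto intro: LeastI_ex)
  with r have "m \<noteq> 0" by (cases m) auto
  then obtain n where n: "m = Suc n" by (cases m) auto
  have "\<not> (1 / 2) ^ n < r"
    using not_less_Least[of n "\<lambda>m. (1 / 2 :: real) ^ m < r"] n by (simp add: m_def)
  then have n1: "r \<le> 1 / 2 ^ n" and n2: "1 / 2 ^ n \<le> 2 * r"
    using m by (auto simp: n power_divide)
  \<comment> \<open>For a negative floor, \<open>nat\<close> yields index 0. This is harmless, since
    points of \<open>{0..}\<close> have nonnegative floors and the cardinality bound 3
    persists.\<close>
  define B where "B = (\<lambda>i. (n, nat i)) ` {\<lfloor>x * 2 ^ n\<rfloor> - 1, \<lfloor>x * 2 ^ n\<rfloor>, \<lfloor>x * 2 ^ n\<rfloor> + 1}"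
  show thesis
  proof
    show "finite B" by (simp add: B_def)
    show "ball x r \<inter> {0..} \<subseteq> (\<Union>b\<in>B. dyadic b)"
    proof
      fix y assume y: "y \<in> ball x r \<inter> {0..}"
      then have "\<bar>x - y\<bar> < 1 / 2 ^ n" using n1 by (auto simp: dist_real_def)
      then have "\<bar>x - y\<bar> * 2 ^ n < 1" by (simp add: field_simps)
      then have "\<bar>x * 2 ^ n - y * 2 ^ n\<bar> < 1"
        by (simp add: abs_mult flip: left_diff_distrib)
      then have "\<lfloor>y * 2 ^ n\<rfloor> \<in> {\<lfloor>x * 2 ^ n\<rfloor> - 1, \<lfloor>x * 2 ^ n\<rfloor>, \<lfloor>x * 2 ^ n\<rfloor> + 1}"
        by auto linarith
      then have "(n, nat \<lfloor>y * 2 ^ n\<rfloor>) \<in> B" unfolding B_def by (rule imageI)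
      moreover have "y \<in> dyadic (n, nat \<lfloor>y * 2 ^ n\<rfloor>)" using y by (simp add: dyadic_iff)
      ultimately show "y \<in> (\<Union>b\<in>B. dyadic b)" by blast
    qed
    have "card B \<le> 3"
      unfolding B_def by (rule order_trans[OF card_image_le]) (auto simp: card_insert_if)
    have "(\<Sum>b\<in>B. weight s b) = (\<Sum>b\<in>B. (1 / 2 ^ n) powr s)"
      by (rule sum.cong) (auto simp: B_def weight_def)
    also have "\<dots> = card B * (1 / 2 ^ n) powr s" by simp
    also have "\<dots> \<le> 3 * (2 * r) powr s"
      using \<open>card B \<le> 3\<close> n2 s by (intro mult_mono powr_mono2) auto
    also have "\<dots> = 3 * (2 powr s * r powr s)" using r by (simp add: powr_mult)
    also have "\<dots> \<le> 3 * (2 powr 1 * r powr s)"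
      using s by (intro mult_left_mono mult_right_mono powr_mono) auto
    finally show "(\<Sum>b\<in>B. weight s b) \<le> 6 * r powr s" by simp
  qed
qed

lemma sum_UN_le:
  fixes f :: "'b \<Rightarrow> real"
  assumes "finite I" "\<And>i. i \<in> I \<Longrightarrow> finite (B i)" "\<And>b. 0 \<le> f b"
  shows "(\<Sum>b\<in>(\<Union>i\<in>I. B i). f b) \<le> (\<Sum>i\<in>I. \<Sum>b\<in>B i. f b)"
  using assms(1,2)
proof (induction I)
  case (insert i I)
  have "(\<Sum>b\<in>(\<Union>i\<in>insert i I. B i). f b) \<le> (\<Sum>b\<in>B i. f b) + (\<Sum>b\<in>(\<Union>i\<in>I. B i). f b)"
    using insert.hyps insert.prems by (simp, subst sum_Un) (auto intro!: sum_nonneg assms(3))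
  then show ?case using insert by simp
qed simp

text \<open>Each refinement costs a little of the exponent, and the exponents
  \<open>\<sigma> j\<close> decrease from t but stay above s. So every \<open>K j\<close> has dyadic
  s-content at least 1, while a cheap cover of the intersection would, by compactness, become a
  cheap dyadic cover of some \<open>K j\<close>.\<close>

lemma hausdorff_measure_ubiquitous_INT:
  fixes U :: "nat \<Rightarrow> real set"
  assumes s: "0 < s" "s < t" "t \<le> 1" and U: "\<And>j. ubiquitous t (U j)"
  shows "hausdorff_measure s (\<Inter>j. U j) \<noteq> 0"
proof
  define T where "T = (\<Inter>j. U j)"
  define \<sigma> where "\<sigma> j = s + (t - s) / 2 ^ j" for j :: nat
  define P where "P j K \<longleftrightarrow> (\<exists>n S. S \<subseteq> {..<2 ^ n} \<and> K = dyadic_union n S) \<and> dyadic_content_ge (\<sigma> j) 1 K" for j K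
  have \<sigma>: "s < \<sigma> j" "\<sigma> (Suc j) < \<sigma> j" "\<sigma> j \<le> t" for j
  proof -
    show "s < \<sigma> j" "\<sigma> (Suc j) < \<sigma> j" using s by (auto simp: \<sigma>_def field_simps)
    have "(t - s) / 2 ^ j \<le> (t - s) / 1" using s by (intro divide_left_mono) auto
    then show "\<sigma> j \<le> t" by (simp add: \<sigma>_def)
  qed
  have "\<exists>K. \<forall>j. P j (K j) \<and> K (Suc j) \<subseteq> K j \<and> closure (K (Suc j)) \<subseteq> U j"
  proof (rule dependent_nat_choice)
    have "dyadic_content_ge (\<sigma> 0) 1 (dyadic_union 0 {0})" using s \<sigma>(3)[of 0] by (intro dyadic_content_ge_unit) simp
    then show "\<exists>K. P 0 K" unfolding P_def by (intro exI conjI[rotated]) auto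
  next
    fix K j assume "P j K"
    then obtain n S where S: "S \<subseteq> {..<2 ^ n}" "K = dyadic_union n S" "dyadic_content_ge (\<sigma> j) 1 (dyadic_union n S)"
      unfolding P_def by blast
    obtain m S' where "S' \<subseteq> {..<2 ^ m}" "dyadic_union m S' \<subseteq> dyadic_union n S"
      "closure (dyadic_union m S') \<subseteq> U j" "dyadic_content_ge (\<sigma> (Suc j)) 1 (dyadic_union m S')"
      using ubiquitous_refine[OF U[of j] \<sigma>(2)[of j] \<sigma>(3)[of j] S(1,3)] .
    then show "\<exists>K'. P (Suc j) K' \<and> K' \<subseteq> K \<and> closure K' \<subseteq> U j"
      unfolding P_def S(2) by blast
  qed
  then obtain K where K: "\<And>j. P j (K j)" "\<And>j. K (Suc j) \<subseteq> K j" "\<And>j. closure (K (Suc j)) \<subseteq> U j"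
    by blast
  have Kunit: "K j \<subseteq> {0..<1}" for j
    using K(1)[of j] dyadic_union_subset_unit unfolding P_def by blast
  have Kcompact: "compact (closure (K j))" for j
  proof -
    have "K j \<subseteq> {0..1}" using Kunit[of j] by auto
    then have "bounded (K j)" by (rule bounded_subset[OF bounded_closed_interval])
    then show ?thesis by simp
  qed
  have Kanti: "K j \<subseteq> K i" if "i \<le> j" for i j
    using K(2) that by (rule lift_Suc_antimono_le)
  have KT: "(\<Inter>j. closure (K j)) \<subseteq> T" using K(3) by (auto simp: T_def)
  assume "hausdorff_measure s (\<Inter>j. U j) = 0"
  then have "hausdorff_pre s 1 T = 0"
    unfolding hausdorff_measure_def T_def[symmetric]
    by (metis (no_types, lifting) SUP_upper greaterThan_iff le_zero_eq zero_less_one)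
  \<comment> \<open>The bound 1/20 leaves room for an equal loss in fattening the cover to open
    balls and for the factor 6 of \<open>ball_dyadic_cover\<close>: 6 (1/20 + 1/20) < 1.\<close>
  then have "hausdorff_pre s 1 T < ennreal (1 / 20)" by simp
  then obtain V where V: "T \<subseteq> (\<Union>i. V i)" "\<And>i. bounded (V i)"
    and Vs: "(\<Sum>i. ennreal (diameter (V i) powr s)) < ennreal (1 / 20)"
    unfolding hausdorff_pre_def by (auto simp: INF_less_iff)
  have Vsum: "(\<Sum>i\<in>F. diameter (V i) powr s) < 1 / 20" if "finite F" for F
  proof -
    have "ennreal (\<Sum>i\<in>F. diameter (V i) powr s) = (\<Sum>i\<in>F. ennreal (diameter (V i) powr s))"
      by (simp add: sum_ennreal)
    also have "\<dots> \<le> (\<Sum>i. ennreal (diameter (V i) powr s))"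
      using that by (intro sum_le_suminf) auto
    also note Vs
    finally show ?thesis by (subst (asm) ennreal_less_iff) (auto intro: sum_nonneg)
  qed
  have gsum: "(\<Sum>i\<in>F. (1 / 20) * (1 / 2 :: real) ^ Suc i) \<le> 1 / 20" if "finite F" for F
  proof -
    have *: "(\<lambda>i. (1 / 20) * (1 / 2 :: real) ^ Suc i) sums (1 / 20)"
      using sums_mult[OF power_half_series, of "1 / 20"] by simp
    have "(\<Sum>i\<in>F. (1 / 20) * (1 / 2 :: real) ^ Suc i) \<le> (\<Sum>i. (1 / 20) * (1 / 2 :: real) ^ Suc i)"
      using that * by (intro sum_le_suminf) (auto simp: sums_iff)
    then show ?thesis using * by (simp add: sums_iff)
  qed
  \<comment> \<open>The radius strictly exceeds the diameter, even when that is 0, so an open ball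
    about any point of \<open>V i\<close> contains \<open>V i\<close>. The extra terms sum to at
    most 1/20.\<close>
  define r where "r i = (diameter (V i) powr s + (1 / 20) * (1 / 2) ^ Suc i) powr (1 / s)" for i
  have rs: "r i powr s = diameter (V i) powr s + (1 / 20) * (1 / 2) ^ Suc i" for i
    unfolding r_def using s by (simp add: powr_powr add_nonneg_nonneg)
  have rpos: "0 < r i" for i
  proof -
    have "0 < diameter (V i) powr s + (1 / 20) * (1 / 2) ^ Suc i" by (intro add_nonneg_pos) auto
    then show ?thesis unfolding r_def by (metis less_irrefl powr_gt_zero)
  qed
  have rgt: "diameter (V i) < r i" for i
  proof -
    have "diameter (V i) powr s < r i powr s" unfolding rs by simp
    then show ?thesis using s rpos[of i] by (smt (verit) powr_mono2)
  qed
  have r1: "r i < 1" for i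
  proof -
    have "r i powr s < 1 powr s"
      using Vsum[of "{i}"] gsum[of "{i}"] by (simp add: rs)
    then show ?thesis using s by (smt (verit) powr_mono2)
  qed
  \<comment> \<open>An empty \<open>V i\<close> has no point to serve as centre.\<close>
  define O' where "O' i = (if V i = {} then {} else ball (SOME x. x \<in> V i) (r i))" for i
  have VO: "V i \<subseteq> O' i" for i
  proof
    fix y assume y: "y \<in> V i"
    then have "(SOME x. x \<in> V i) \<in> V i" by (rule someI)
    then have "dist (SOME x. x \<in> V i) y \<le> diameter (V i)"
      using y V(2) by (intro diameter_bounded_bound)
    then show "y \<in> O' i" using rgt[of i] y by (auto simp: O'_def)
  qed
  have openO: "open (O' i)" for i by (simp add: O'_def)
  \<comment> \<open>Otherwise the nested nonempty compact sets
    \<open>closure (K j) - (\<Union>i. O' i)\<close> have a common point. It lies in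
    \<open>T\<close>, hence in some \<open>V i\<close>, hence in \<open>O' i\<close>.\<close>
  have "\<exists>j. closure (K j) \<subseteq> (\<Union>i. O' i)"
  proof (rule ccontr)
    assume no: "\<nexists>j. closure (K j) \<subseteq> (\<Union>i. O' i)"
    have "(\<Inter>j. closure (K j) - (\<Union>i. O' i)) \<noteq> {}"
    proof (rule compact_nest)
      show "compact (closure (K j) - (\<Union>i. O' i))" for j
        using Kcompact openO by (intro compact_diff) auto
      show "closure (K j) - (\<Union>i. O' i) \<noteq> {}" for j using no by auto
      show "closure (K j) - (\<Union>i. O' i) \<subseteq> closure (K i) - (\<Union>i. O' i)" if "i \<le> j" for i j
        using closure_mono[OF Kanti[OF that]] by blast
    qed
    then obtain x where x: "\<And>j. x \<in> closure (K j) - (\<Union>i. O' i)"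
      unfolding ex_in_conv[symmetric] by (elim exE) (simp only: INT_iff UNIV_I ball_simps simp_thms, blast)
    then have "x \<in> (\<Inter>j. closure (K j))" by simp
    with KT V(1) have "x \<in> (\<Union>i. V i)" by (meson subsetD)
    then show False using x[of 0] VO by blast
  qed
  then obtain j where "closure (K j) \<subseteq> (\<Union>i. O' i)" by blast
  then obtain F where F: "finite F" "closure (K j) \<subseteq> (\<Union>i\<in>F. O' i)"
    by (rule compactE_image[OF Kcompact openO])
  have "\<exists>B. finite B \<and> O' i \<inter> {0..} \<subseteq> (\<Union>b\<in>B. dyadic b) \<and> (\<Sum>b\<in>B. weight s b) \<le> 6 * r i powr s" for i
  proof (cases "V i = {}")
    case True
    then show ?thesis by (intro exI[of _ "{}"]) (auto simp: O'_def)
  next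
    case False
    then show ?thesis
      using ball_dyadic_cover[of s "r i" "SOME x. x \<in> V i"] s rpos[of i] r1[of i]
      by (simp add: O'_def) metis
  qed
  then obtain B where B: "\<And>i. finite (B i)" "\<And>i. O' i \<inter> {0..} \<subseteq> (\<Union>b\<in>B i. dyadic b)"
    "\<And>i. (\<Sum>b\<in>B i. weight s b) \<le> 6 * r i powr s" by metis
  have "K j \<subseteq> (\<Union>b\<in>(\<Union>i\<in>F. B i). dyadic b)"
  proof
    fix x assume x: "x \<in> K j"
    then have "x \<in> (\<Union>i\<in>F. O' i)" using F(2) closure_subset by blast
    moreover have "x \<in> {0..}" using x Kunit[of j] by auto
    ultimately show "x \<in> (\<Union>b\<in>(\<Union>i\<in>F. B i). dyadic b)" using B(2) by blast
  qed
  moreover have "dyadic_content_ge s 1 (K j)"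
    using K(1)[of j] \<sigma>(1)[of j] unfolding P_def by (meson dyadic_content_ge_antimono less_imp_le)
  ultimately have "1 \<le> (\<Sum>b\<in>(\<Union>i\<in>F. B i). weight s b)"
    using F(1) B(1) unfolding dyadic_content_ge_def by (metis finite_UN_I)
  also have "\<dots> \<le> (\<Sum>i\<in>F. \<Sum>b\<in>B i. weight s b)" using F(1) B(1) by (intro sum_UN_le) auto
  also have "\<dots> \<le> (\<Sum>i\<in>F. 6 * r i powr s)" by (intro sum_mono B(3))
  also have "\<dots> = 6 * ((\<Sum>i\<in>F. diameter (V i) powr s) + (\<Sum>i\<in>F. (1 / 20) * (1 / 2) ^ Suc i))"
    by (simp add: rs sum_distrib_left sum.distrib distrib_left)
  also have "\<dots> < 6 * (1 / 20 + 1 / 20)"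
    using Vsum[OF F(1)] gsum[OF F(1)] by (intro mult_strict_left_mono add_less_le_mono) auto
  finally show False by simp
qed

section \<open>Inner approximation by dyadic intervals\<close>

lemma hausdorff_content_dyadic_le: "hausdorff_content t (dyadic b) \<le> ennreal (weight t b)"
proof -
  have "dyadic b \<subseteq> {real (snd b) / 2 ^ fst b..real (snd b) / 2 ^ fst b + 1 / 2 ^ fst b}"
    by (auto simp: dyadic_def add_divide_distrib)
  then have "hausdorff_content t (dyadic b) \<le> hausdorff_content t {real (snd b) / 2 ^ fst b..real (snd b) / 2 ^ fst b + 1 / 2 ^ fst b}"
    by (rule hausdorff_content_mono)
  also have "\<dots> \<le> ennreal (weight t b)" unfolding weight_def by (rule hausdorff_content_atLeastAtMost_le) simp
  finally show ?thesis .
qed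

text \<open>Points of \<open>A\<close> are missed by the level-m intervals inside \<open>A\<close>
  only near an endpoint of one of the finitely many pieces. The missed part has content at most
  \<open>card I\<close> times 2 (2^-m)^t, which drops below c and so leaves c out of 2c.\<close>

lemma dyadic_inner_approximation:
  fixes \<alpha> \<beta> :: "'i \<Rightarrow> real"
  assumes I: "finite I" and A: "A = (\<Union>i\<in>I. {\<alpha> i..<\<beta> i})" "A \<subseteq> {0..<1}"
    and c: "0 < c" "ennreal (2 * c) \<le> hausdorff_content t A" and t: "0 < t"
  shows "\<forall>\<^sub>F m in sequentially. \<exists>S\<subseteq>{..<2 ^ m}. (\<forall>l\<in>S. closure (dyadic (m, l)) \<subseteq> A) \<and>
    dyadic_union m S \<subseteq> A \<and> dyadic_content_ge t c (dyadic_union m S)"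
proof -
  have "(\<lambda>m. real (card I) * (2 * (1 / 2 ^ m) powr t)) \<longlonglongrightarrow> real (card I) * (2 * 0)"
    by (intro tendsto_mult tendsto_const tendsto_half_power_powr t)
  then have "\<forall>\<^sub>F m in sequentially. real (card I) * (2 * (1 / 2 ^ m) powr t) < c"
    using c(1) by (intro order_tendstoD(2)[of _ "real (card I) * (2 * 0)"]) auto
  then show ?thesis
  proof (rule eventually_mono)
    fix m assume m: "real (card I) * (2 * (1 / 2 ^ m) powr t) < c"
    define S where "S = {l. l < 2 ^ m \<and> closure (dyadic (m, l)) \<subseteq> A}"
    define R where "R i = {\<alpha> i..\<alpha> i + 1 / 2 ^ m} \<union> {\<beta> i - 1 / 2 ^ m..(\<beta> i - 1 / 2 ^ m) + 1 / 2 ^ m}" for i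
    have cov: "A \<subseteq> dyadic_union m S \<union> (\<Union>i\<in>I. R i)"
    proof
      fix x assume x: "x \<in> A"
      then obtain i where i: "i \<in> I" "x \<in> {\<alpha> i..<\<beta> i}" unfolding A by blast
      have x01: "0 \<le> x" "x < 1" using x A(2) by auto
      define l where "l = nat \<lfloor>x * 2 ^ m\<rfloor>"
      have xl: "x \<in> dyadic (m, l)" using x01 by (simp add: dyadic_iff l_def)
      have "real l / 2 ^ m \<le> x" "x < (real l + 1) / 2 ^ m" using xl by (auto simp: dyadic_def)
      moreover have sp: "(real l + 1) / 2 ^ m = real l / 2 ^ m + 1 / 2 ^ m" by (simp add: add_divide_distrib)
      moreover have "real l * 1 < 2 ^ m"
      proof -
        have "real l / 2 ^ m < 1" using calculation x01 by linarith
        then show ?thesis by simp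
      qed
      then have "l < 2 ^ m" by (metis mult.right_neutral of_nat_less_numeral_power_cancel_iff)
      moreover have "closure (dyadic (m, l)) = {real l / 2 ^ m..real l / 2 ^ m + 1 / 2 ^ m}"
        by (simp add: dyadic_def closure_atLeastLessThan divide_strict_right_mono sp)
      ultimately show "x \<in> dyadic_union m S \<union> (\<Union>i\<in>I. R i)"
      \<comment> \<open>The second inequality is strict because the closed dyadic interval must fit
        in a half-open piece. If either fails, \<open>x\<close> is within 2^-m of
        \<open>\<alpha> i\<close> or \<open>\<beta> i\<close>.\<close>
      proof (cases "\<alpha> i \<le> real l / 2 ^ m \<and> real l / 2 ^ m + 1 / 2 ^ m < \<beta> i")
        case True
        then have "{real l / 2 ^ m..real l / 2 ^ m + 1 / 2 ^ m} \<subseteq> {\<alpha> i..<\<beta> i}" by auto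
        then have "closure (dyadic (m, l)) \<subseteq> A"
          unfolding A(1) \<open>closure (dyadic (m, l)) = _\<close> using i(1) by blast
        then show ?thesis using xl \<open>l < 2 ^ m\<close> by (auto simp: S_def dyadic_union_def)
      next
        case False
        then have "x \<in> R i"
          using i(2) \<open>real l / 2 ^ m \<le> x\<close> \<open>x < (real l + 1) / 2 ^ m\<close> unfolding sp R_def by auto
        then show ?thesis using i(1) by blast
      qed
    qed
    have R: "hausdorff_content t (\<Union>i\<in>I. R i) \<le> ennreal c"
    proof -
      have "hausdorff_content t (R i) \<le> ennreal (2 * (1 / 2 ^ m) powr t)" for i
      proof -
        let ?J = "\<lambda>b. if b then {\<alpha> i..\<alpha> i + 1 / 2 ^ m} else {\<beta> i - 1 / 2 ^ m..(\<beta> i - 1 / 2 ^ m) + 1 / 2 ^ m}"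
        have "R i = (\<Union>b\<in>UNIV. ?J b)" by (auto simp: R_def UNIV_bool)
        then have "hausdorff_content t (R i) \<le> (\<Sum>b\<in>UNIV. hausdorff_content t (?J b))" by (simp only: hausdorff_content_UN_finite[OF finite])
        also have "\<dots> \<le> (\<Sum>b\<in>(UNIV::bool set). ennreal ((1 / 2 ^ m) powr t))"
          by (intro sum_mono) (simp only: hausdorff_content_atLeastAtMost_le zero_le_divide_1_iff zero_le_numeral zero_le_power simp_thms split: if_split)
        also have "\<dots> = ennreal (2 * (1 / 2 ^ m) powr t)" by (simp add: ennreal_mult)
        finally show ?thesis .
      qed
      then have "hausdorff_content t (\<Union>i\<in>I. R i) \<le> (\<Sum>i\<in>I. ennreal (2 * (1 / 2 ^ m) powr t))"
        by (intro order_trans[OF hausdorff_content_UN_finite[OF I]] sum_mono)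
      also have "\<dots> = ennreal (real (card I) * (2 * (1 / 2 ^ m) powr t))"
        by (simp add: ennreal_mult ennreal_of_nat_eq_real_of_nat)
      also have "\<dots> \<le> ennreal c" using m by (intro ennreal_leI) simp
      finally show ?thesis .
    qed
    show "\<exists>S\<subseteq>{..<2 ^ m}. (\<forall>l\<in>S. closure (dyadic (m, l)) \<subseteq> A) \<and> dyadic_union m S \<subseteq> A \<and> dyadic_content_ge t c (dyadic_union m S)"
    proof (intro exI[of _ S] conjI)
      show "S \<subseteq> {..<2 ^ m}" "\<forall>l\<in>S. closure (dyadic (m, l)) \<subseteq> A" by (auto simp: S_def)
      then show "dyadic_union m S \<subseteq> A" using closure_subset unfolding dyadic_union_def by blast
      show "dyadic_content_ge t c (dyadic_union m S)"
        unfolding dyadic_content_ge_def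
      proof (intro allI impI)
        fix B assume B: "finite B" "dyadic_union m S \<subseteq> (\<Union>b\<in>B. dyadic b)"
        have "hausdorff_content t A \<le> hausdorff_content t (\<Union>k\<in>UNIV. if k then (\<Union>b\<in>B. dyadic b) else (\<Union>i\<in>I. R i))"
          using cov B(2) by (intro hausdorff_content_mono) (auto simp: UNIV_bool)
        also have "\<dots> \<le> hausdorff_content t (\<Union>b\<in>B. dyadic b) + hausdorff_content t (\<Union>i\<in>I. R i)"
          by (rule order_trans[OF hausdorff_content_UN_finite[OF finite]]) (simp add: UNIV_bool add.commute)
        also have "\<dots> \<le> (\<Sum>b\<in>B. ennreal (weight t b)) + ennreal c"
          by (intro add_mono R order_trans[OF hausdorff_content_UN_finite[OF B(1)]] sum_mono hausdorff_content_dyadic_le)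
        also have "\<dots> = ennreal ((\<Sum>b\<in>B. weight t b) + c)"
          using c(1) by (simp add: sum_ennreal sum_nonneg)
        finally have "ennreal (2 * c) \<le> ennreal ((\<Sum>b\<in>B. weight t b) + c)"
          using c(2) by (rule order_trans[rotated])
        then have "2 * c \<le> (\<Sum>b\<in>B. weight t b) + c"
          using c(1) by (subst (asm) ennreal_le_iff) (auto intro!: add_nonneg_nonneg sum_nonneg)
        then show "c \<le> (\<Sum>b\<in>B. weight t b)" by simp
      qed
    qed
  qed
qed

section \<open>Cylinders of full-branch maps\<close>

locale full_branch_map =
  fixes f :: "real \<Rightarrow> real" and a :: "nat \<Rightarrow> real" and g :: nat
  assumes setting: "setting f a g" and cond_i: "cond_i f a g"
begin

lemma a_less: "k < g \<Longrightarrow> a k < a (Suc k)"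
  using setting by (simp add: setting_def)

lemma a_mono: "i \<le> j \<Longrightarrow> j \<le> g \<Longrightarrow> a i \<le> a j"
proof (induction j)
  case (Suc j)
  then show ?case using a_less[of j] by (cases "i = Suc j") auto
qed simp

lemma a_0: "a 0 = 0" and a_g: "a g = 1" and g_pos: "0 < g"
  using setting by (auto simp: setting_def)

lemma pint_unit: "k < g \<Longrightarrow> pint a k \<subseteq> {0..<1}"
  using a_mono[of 0 k] a_mono[of "Suc k" g] by (auto simp: pint_def a_0 a_g)

lemma pint_unique:
  assumes "k < g" "l < g" "y \<in> pint a k" "y \<in> pint a l"
  shows "k = l"
proof (rule ccontr)
  assume "k \<noteq> l"
  then consider "Suc k \<le> l" | "Suc l \<le> k" by linarith
  then show False
    using a_mono[of "Suc k" l] a_mono[of "Suc l" k] assms by cases (auto simp: pint_def)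
qed

lemma pint_ex:
  assumes "y \<in> {0..<1}"
  obtains k where "k < g" "y \<in> pint a k"
proof -
  have "\<exists>k<j. y \<in> pint a k" if "y < a j" "j \<le> g" for j
    using that
  proof (induction j)
    case 0
    then show ?case using assms a_0 by simp
  next
    case (Suc j)
    then show ?case by (cases "y < a j") (auto simp: pint_def less_Suc_eq)
  qed
  from this[of g] show thesis using that assms a_g by auto
qed

lemma digit_eq: "k < g \<Longrightarrow> y \<in> pint a k \<Longrightarrow> digit a g y = k"
  unfolding digit_def by (rule the_equality) (auto intro: pint_unique)

lemma digit_less: "y \<in> {0..<1} \<Longrightarrow> digit a g y < g"
  and pint_digit: "y \<in> {0..<1} \<Longrightarrow> y \<in> pint a (digit a g y)"
  using digit_eq by (metis pint_ex)+

lemma f_unit: "x \<in> {0..<1} \<Longrightarrow> f x \<in> {0..<1}"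
  using setting unfolding setting_def by blast

lemma funpow_unit: "x \<in> {0..<1} \<Longrightarrow> (f ^^ n) x \<in> {0..<1}"
  by (induction n) (use f_unit in auto)

lemma f_pint_image: "k < g \<Longrightarrow> f ` pint a k = {0..<1}"
  using setting unfolding setting_def by blast

text \<open>A decreasing branch would attain the maximum of its image \<open>[0,1)\<close> at the left endpoint.\<close>

lemma f_strict_mono:
  assumes k: "k < g"
  shows "strict_mono_on (pint a k) f"
proof -
  have left: "a k \<in> pint a k" using a_less[OF k] by (simp add: pint_def)
  have "\<not> monotone_on (pint a k) (\<le>) (\<ge>) f"
  proof
    assume anti: "monotone_on (pint a k) (\<le>) (\<ge>) f"
    have "f (a k) < 1" using f_pint_image[OF k] left by force
    then obtain y where y: "f (a k) < y" "y < 1" using dense by blast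
    moreover have "0 \<le> f (a k)" using f_pint_image[OF k] left by force
    ultimately have "y \<in> f ` pint a k" using f_pint_image[OF k] by auto
    then obtain z where "z \<in> pint a k" "y = f z" by blast
    then show False using monotone_onD[OF anti left, of z] y by (auto simp: pint_def)
  qed
  then have mono: "mono_on (pint a k) f" using setting k unfolding setting_def by blast
  \<comment> \<open>Expansion excludes equal values at distinct points and so makes monotonicity
    strict.\<close>
  have exp: "\<bar>x - y\<bar> \<le> \<bar>f x - f y\<bar>" if "x \<in> pint a k" "y \<in> pint a k" for x y
    using setting k that unfolding setting_def by blast
  show ?thesis
  proof (rule strict_mono_onI)
    fix x y assume xy: "x \<in> pint a k" "y \<in> pint a k" "x < y"
    then show "f x < f y" using mono_onD[OF mono xy(1,2)] exp[OF xy(1,2)] by auto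
  qed
qed

lemma f_has_derivative:
  assumes "k < g" "x \<in> pint a k"
  obtains D where "(f has_real_derivative D) (at x within pint a k)"
proof -
  have "f differentiable (at x within pint a k)" using setting assms by (simp add: setting_def)
  then show thesis using that by (auto simp: real_differentiable_def)
qed

lemma cyl_snoc: "cyl f a g (w @ [k]) = {x \<in> cyl f a g w. (f ^^ length w) x \<in> pint a k}"
  by (auto simp: cyl_def nth_append less_Suc_eq)

end

text \<open>Surjectivity, in place of continuity, supplies preimages of \<open>p\<close> and
  \<open>q\<close>, and strict monotonicity makes them the endpoints.\<close>

lemma strict_mono_on_vimage_interval:
  fixes h :: "real \<Rightarrow> real"
  assumes mono: "strict_mono_on {\<alpha>..<\<beta>} h" and onto: "h ` {\<alpha>..<\<beta>} = {0..<1}"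
    and pq: "0 \<le> p" "p < q" "q \<le> 1"
  obtains \<alpha>' \<beta>' where "\<alpha>' < \<beta>'" "{x \<in> {\<alpha>..<\<beta>}. h x \<in> {p..<q}} = {\<alpha>'..<\<beta>'}"
    "h ` {\<alpha>'..<\<beta>'} = {p..<q}"
proof -
  have ex: "\<exists>x\<in>{\<alpha>..<\<beta>}. h x = v" if "0 \<le> v" "v < 1" for v
    using that onto by (metis (no_types, lifting) atLeastLessThan_iff imageE)
  obtain x where x: "x \<in> {\<alpha>..<\<beta>}" "h x = p" using ex[of p] pq by auto
  have px: "p \<le> h y \<longleftrightarrow> x \<le> y" if "y \<in> {\<alpha>..<\<beta>}" for y
    using strict_mono_on_less_eq[OF mono x(1) that] x(2) by simp
  obtain z where z: "x < z" "z \<le> \<beta>" "\<And>y. y \<in> {\<alpha>..<\<beta>} \<Longrightarrow> h y < q \<longleftrightarrow> y < z"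
  proof (cases "q = 1")
    \<comment> \<open>The value 1 is not attained; the right end \<open>\<beta>\<close> takes the
      place of its preimage.\<close>
    case True
    have "h y < q" if "y \<in> {\<alpha>..<\<beta>}" for y using onto that True by force
    then show ?thesis using that[of \<beta>] x by auto
  next
    case False
    then obtain z where z: "z \<in> {\<alpha>..<\<beta>}" "h z = q" using ex[of q] pq by auto
    have "h y < q \<longleftrightarrow> y < z" if "y \<in> {\<alpha>..<\<beta>}" for y
      using strict_mono_on_less[OF mono that z(1)] z(2) by simp
    moreover have "x < z" using calculation[OF x(1)] x pq by simp
    ultimately show ?thesis using that[of z] z(1) by auto
  qed
  have eq: "{y \<in> {\<alpha>..<\<beta>}. h y \<in> {p..<q}} = {x..<z}"
  proof (intro set_eqI iffI)
    fix y assume y: "y \<in> {x..<z}"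
    then have "y \<in> {\<alpha>..<\<beta>}" using x(1) z(2) by auto
    then show "y \<in> {y \<in> {\<alpha>..<\<beta>}. h y \<in> {p..<q}}" using y px z(3) by auto
  qed (use px z(3) in auto)
  have "h ` {x..<z} = {p..<q}"
  proof
    show "h ` {x..<z} \<subseteq> {p..<q}" unfolding eq[symmetric] by auto
    show "{p..<q} \<subseteq> h ` {x..<z}"
    proof
      fix v assume v: "v \<in> {p..<q}"
      then obtain y where "y \<in> {\<alpha>..<\<beta>}" "h y = v" using ex[of v] pq by auto
      then show "v \<in> h ` {x..<z}" using v unfolding eq[symmetric] by auto
    qed
  qed
  then show thesis using that[OF z(1) eq] by simp
qed

context full_branch_map
begin

text \<open>Induction by appending a digit: the new cylinder is the preimage of a branch interval
  under the increasing bijection \<open>f ^^ m\<close> of the old one, and \<open>f\<close> maps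
  that branch onto the whole unit interval again. Derivatives are taken within the cylinder, hence
  one-sided at its left end.\<close>

lemma cyl_interval:
  assumes "w \<in> words g n"
  shows "\<exists>\<alpha> \<beta>. \<alpha> < \<beta> \<and> cyl f a g w = {\<alpha>..<\<beta>} \<and> strict_mono_on {\<alpha>..<\<beta>} (f ^^ n) \<and>
    (f ^^ n) ` {\<alpha>..<\<beta>} = {0..<1} \<and>
    (\<forall>x\<in>{\<alpha>..<\<beta>}. \<exists>D. ((f ^^ n) has_real_derivative D) (at x within {\<alpha>..<\<beta>}))"
  using assms
proof (induction w arbitrary: n rule: rev_induct)
  case Nil
  then have "n = 0" by (simp add: words_def)
  moreover have "cyl f a g [] = {0..<1}" by (auto simp: cyl_def)
  ultimately show ?case
    by (intro exI[of _ 0] exI[of _ 1])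
      (auto simp: strict_mono_on_def id_def intro!: exI[of _ 1] DERIV_ident)
next
  case (snoc k w)
  define m where "m = length w"
  have n: "n = Suc m" and k: "k < g" and w: "w \<in> words g m"
    using snoc.prems by (auto simp: words_def m_def)
  obtain \<alpha> \<beta> where IH: "\<alpha> < \<beta>" "cyl f a g w = {\<alpha>..<\<beta>}" "strict_mono_on {\<alpha>..<\<beta>} (f ^^ m)"
    "(f ^^ m) ` {\<alpha>..<\<beta>} = {0..<1}"
    "\<And>x. x \<in> {\<alpha>..<\<beta>} \<Longrightarrow> \<exists>D. ((f ^^ m) has_real_derivative D) (at x within {\<alpha>..<\<beta>})"
    using snoc.IH[OF w] by blast
  have ak: "0 \<le> a k" "a (Suc k) \<le> 1" using a_mono[of 0 k] a_mono[of "Suc k" g] k by (auto simp: a_0 a_g)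
  obtain \<alpha>' \<beta>' where C: "\<alpha>' < \<beta>'" "{x \<in> {\<alpha>..<\<beta>}. (f ^^ m) x \<in> pint a k} = {\<alpha>'..<\<beta>'}"
    "(f ^^ m) ` {\<alpha>'..<\<beta>'} = pint a k"
    using strict_mono_on_vimage_interval[OF IH(3,4) ak(1) a_less[OF k] ak(2)] unfolding pint_def .
  have sub: "{\<alpha>'..<\<beta>'} \<subseteq> {\<alpha>..<\<beta>}" using C(2) by blast
  have fn: "f ^^ n = f \<circ> (f ^^ m)" by (simp add: n)
  have "strict_mono_on {\<alpha>'..<\<beta>'} (f ^^ n)"
  proof (rule strict_mono_onI)
    fix x y assume xy: "x \<in> {\<alpha>'..<\<beta>'}" "y \<in> {\<alpha>'..<\<beta>'}" "x < y"
    then have "(f ^^ m) x < (f ^^ m) y" using sub by (intro strict_mono_onD[OF IH(3)]) auto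
    moreover have "(f ^^ m) x \<in> pint a k" "(f ^^ m) y \<in> pint a k" using C(3) xy by blast+
    ultimately show "(f ^^ n) x < (f ^^ n) y"
      using strict_mono_onD[OF f_strict_mono[OF k]] by (simp add: n)
  qed
  moreover have "(f ^^ n) ` {\<alpha>'..<\<beta>'} = {0..<1}"
    unfolding fn image_comp[symmetric] C(3) by (rule f_pint_image[OF k])
  moreover have "\<exists>D. ((f ^^ n) has_real_derivative D) (at x within {\<alpha>'..<\<beta>'})" if x: "x \<in> {\<alpha>'..<\<beta>'}" for x
  proof -
    obtain D1 where "((f ^^ m) has_real_derivative D1) (at x within {\<alpha>..<\<beta>})"
      using IH(5) x sub by blast
    then have D1: "((f ^^ m) has_real_derivative D1) (at x within {\<alpha>'..<\<beta>'})"
      using sub by (rule has_field_derivative_subset)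
    have "(f ^^ m) x \<in> pint a k" using C(3) x by blast
    \<comment> \<open>The image of the new cylinder under \<open>f ^^ m\<close> is exactly
      \<open>pint a k\<close>, the set within which \<open>f\<close> is differentiated, so the chain
      rule within sets applies.\<close>
    then obtain D2 where "(f has_real_derivative D2) (at ((f ^^ m) x) within (f ^^ m) ` {\<alpha>'..<\<beta>'})"
      using f_has_derivative[OF k] unfolding C(3) by blast
    from DERIV_image_chain[OF this D1] show ?thesis unfolding fn by blast
  qed
  moreover have "cyl f a g (w @ [k]) = {\<alpha>'..<\<beta>'}"
    unfolding cyl_snoc IH(2) C(2)[symmetric] m_def ..
  ultimately show ?case using C(1) by blast
qed

text \<open>The mean value theorem turns the comparison of derivatives into a Lipschitz bound: the
  slope over [x,y] is a derivative D1, the slope D2 over the whole cylinder is at most 1 over its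
  length because the image has length 1, and D1 < K D2.\<close>

lemma bounded_distortion:
  obtains K where "0 < K"
    "\<And>n w \<alpha> \<beta> x y. w \<in> words g n \<Longrightarrow> cyl f a g w = {\<alpha>..<\<beta>} \<Longrightarrow> \<alpha> \<le> x \<Longrightarrow> x \<le> y \<Longrightarrow> y < \<beta> \<Longrightarrow>
       ((f ^^ n) y - (f ^^ n) x) * (\<beta> - \<alpha>) \<le> K * (y - x)"
proof -
  obtain K where K: "0 < K" and dist: "\<And>n w y z Dy Dz. w \<in> words g n \<Longrightarrow> y \<in> cyl f a g w \<Longrightarrow>
      z \<in> cyl f a g w \<Longrightarrow>
      ((f ^^ n) has_real_derivative Dy) (at y within cyl f a g w) \<Longrightarrow>
      ((f ^^ n) has_real_derivative Dz) (at z within cyl f a g w) \<Longrightarrow> \<bar>Dy\<bar> / \<bar>Dz\<bar> < K"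
    using cond_i unfolding cond_i_def by blast
  show thesis
  proof
    show "0 < K" by fact
    fix n w \<alpha> \<beta> x y
    assume w: "w \<in> words g n" and eq: "cyl f a g w = {\<alpha>..<\<beta>}" and xy: "\<alpha> \<le> x" "x \<le> y" "y < (\<beta> :: real)"
    let ?h = "f ^^ n"
    obtain \<alpha>1 \<beta>1 where s1: "\<alpha>1 < \<beta>1" "cyl f a g w = {\<alpha>1..<\<beta>1}" "strict_mono_on {\<alpha>1..<\<beta>1} ?h"
      "?h ` {\<alpha>1..<\<beta>1} = {0..<1}"
      "\<And>x. x \<in> {\<alpha>1..<\<beta>1} \<Longrightarrow> \<exists>D. (?h has_real_derivative D) (at x within {\<alpha>1..<\<beta>1})"
      using cyl_interval[OF w] by blast
    have e: "{\<alpha>1..<\<beta>1} = {\<alpha>..<\<beta>}" using s1(2) eq by simp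
    note s = s1(3,4,5)[unfolded e]
    have mvt: "\<exists>z D. z \<in> {\<alpha>..<\<beta>} \<and> (?h has_real_derivative D) (at z within {\<alpha>..<\<beta>}) \<and>
        ?h v - ?h u = (v - u) * D" if uv: "\<alpha> \<le> u" "u < v" "v < \<beta>" for u v
    proof -
      have sub: "{u..v} \<subseteq> {\<alpha>..<\<beta>}" using uv by auto
      have "continuous_on {\<alpha>..<\<beta>} ?h"
        unfolding continuous_on_eq_continuous_within using s(3) DERIV_continuous by blast
      then have "continuous_on {u..v} ?h" using sub by (rule continuous_on_subset)
      moreover have "?h differentiable (at z)" if z: "u < z" "z < v" for z
      proof -
        have "at z within {\<alpha>..<\<beta>} = at z" using z uv by (intro at_within_interior) auto
        then show ?thesis using s(3)[of z] z uv by (auto simp: real_differentiable_def)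
      qed
      ultimately obtain l z where "u < z" "z < v" "DERIV ?h z :> l" "?h v - ?h u = (v - u) * l"
        using MVT[OF uv(2)] by blast
      then show ?thesis using uv
        by (intro exI[of _ z] exI[of _ l]) (auto intro: has_field_derivative_at_within)
    qed
    show "(?h y - ?h x) * (\<beta> - \<alpha>) \<le> K * (y - x)"
    proof (cases "x = y")
      case False
      then have xy': "x < y" using xy by simp
      define c where "c = ?h y - ?h x"
      have c: "0 < c" using strict_mono_onD[OF s(1), of x y] xy xy' by (simp add: c_def)
      obtain z1 D1 where z1: "z1 \<in> {\<alpha>..<\<beta>}" "(?h has_real_derivative D1) (at z1 within {\<alpha>..<\<beta>})"
        "c = (y - x) * D1"
        using mvt[OF xy(1) xy' xy(3)] unfolding c_def by blast
      have D1: "0 < D1" using c z1(3) xy' by (simp add: zero_less_mult_iff)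
      \<comment> \<open>The right end is not in the cylinder, so the second mean value argument runs
        on [\<alpha>,v] for v < \<beta> and v tends to \<beta>.\<close>
      have "\<beta> \<le> K * (y - x) / c + \<alpha>"
      proof (rule dense_le_bounded)
        show "\<alpha> < \<beta>" using xy by simp
        fix v assume v: "\<alpha> < v" "v < \<beta>"
        obtain z2 D2 where z2: "z2 \<in> {\<alpha>..<\<beta>}" "(?h has_real_derivative D2) (at z2 within {\<alpha>..<\<beta>})"
          "?h v - ?h \<alpha> = (v - \<alpha>) * D2"
          using mvt[OF order_refl v] by blast
        have "0 < ?h v - ?h \<alpha>" using strict_mono_onD[OF s(1), of \<alpha> v] v by simp
        then have D2: "0 < D2" using z2(3) v by (simp add: zero_less_mult_iff)
        have "?h v \<in> {0..<1}" "?h \<alpha> \<in> {0..<1}" using s(2) v by (metis atLeastLessThan_iff imageI less_imp_le less_trans order_refl)+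
        then have le1: "(v - \<alpha>) * D2 \<le> 1" unfolding z2(3)[symmetric] by auto
        have "\<bar>D1\<bar> / \<bar>D2\<bar> < K"
          using dist[OF w, of z1 z2 D1 D2] z1 z2 by (simp add: eq)
        then have "D1 \<le> K * D2" using D1 D2 by (simp add: field_simps)
        then have "c * (v - \<alpha>) \<le> (y - x) * (K * D2) * (v - \<alpha>)"
          unfolding z1(3) using xy v by (intro mult_right_mono mult_left_mono) auto
        also have "\<dots> = K * (y - x) * ((v - \<alpha>) * D2)" by (simp add: mult_ac)
        also have "\<dots> \<le> K * (y - x) * 1" using le1 K xy by (intro mult_left_mono) auto
        finally show "v \<le> K * (y - x) / c + \<alpha>" using c by (simp add: field_simps)
      qed
      then show ?thesis using c by (simp add: field_simps c_def[symmetric])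
    qed simp
  qed
qed

text \<open>The iterate maps the child onto a branch interval of length at least \<rho>, the
  shortest branch length, while its slope is at most K over the length of the parent. Hence the
  ratio \<rho>/K.\<close>

lemma cyl_child_ratio:
  obtains \<kappa> where "0 < \<kappa>"
    "\<And>n w k \<alpha> \<beta> \<alpha>' \<beta>'. w \<in> words g n \<Longrightarrow> k < g \<Longrightarrow> cyl f a g w = {\<alpha>..<\<beta>} \<Longrightarrow> \<alpha> < \<beta> \<Longrightarrow>
       cyl f a g (w @ [k]) = {\<alpha>'..<\<beta>'} \<Longrightarrow> \<alpha>' < \<beta>' \<Longrightarrow> \<kappa> * (\<beta> - \<alpha>) \<le> \<beta>' - \<alpha>'"
proof -
  obtain K where K: "0 < K" and dist: "\<And>n w \<alpha> \<beta> x y. w \<in> words g n \<Longrightarrow> cyl f a g w = {\<alpha>..<\<beta>} \<Longrightarrow>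
      \<alpha> \<le> x \<Longrightarrow> x \<le> y \<Longrightarrow> y < \<beta> \<Longrightarrow> ((f ^^ n) y - (f ^^ n) x) * (\<beta> - \<alpha>) \<le> K * (y - x)"
    using bounded_distortion by blast
  define \<rho> where "\<rho> = Min ((\<lambda>k. a (Suc k) - a k) ` {..<g})"
  have "\<rho> \<in> (\<lambda>k. a (Suc k) - a k) ` {..<g}"
    unfolding \<rho>_def using g_pos by (intro Min_in) auto
  then have \<rho>: "0 < \<rho>" "\<And>k. k < g \<Longrightarrow> \<rho> \<le> a (Suc k) - a k"
    using a_less by (auto simp: \<rho>_def)
  show thesis
  proof
    show "0 < \<rho> / K" using K \<rho> by simp
    fix n w k \<alpha> \<beta> \<alpha>' \<beta>'
    assume w: "w \<in> words g n" and k: "k < g" and C: "cyl f a g w = {\<alpha>..<\<beta>}" "\<alpha> < \<beta>"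
      and C': "cyl f a g (w @ [k]) = {\<alpha>'..<\<beta>'}" "\<alpha>' < \<beta>'"
    let ?h = "f ^^ n"
    have len: "length w = n" using w by (simp add: words_def)
    have S: "strict_mono_on {\<alpha>..<\<beta>} ?h" "?h ` {\<alpha>..<\<beta>} = {0..<1}"
      using cyl_interval[OF w] C(1) by auto
    have C'eq: "{x \<in> {\<alpha>..<\<beta>}. ?h x \<in> pint a k} = {\<alpha>'..<\<beta>'}"
      using C'(1) unfolding cyl_snoc len C(1) .
    have ex: "\<exists>x\<in>{\<alpha>'..<\<beta>'}. ?h x = v" if "v \<in> pint a k" for v
    proof -
      have "v \<in> ?h ` {\<alpha>..<\<beta>}" using that pint_unit[OF k] S(2) by blast
      then show ?thesis using that unfolding C'eq[symmetric] by auto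
    qed
    obtain x where x: "x \<in> {\<alpha>'..<\<beta>'}" "?h x = a k"
      using ex[of "a k"] a_less[OF k] by (auto simp: pint_def)
    \<comment> \<open>The right end of the branch is not attained, so it is approached by attained
      values v.\<close>
    have "a (Suc k) \<le> a k + K * (\<beta>' - \<alpha>') / (\<beta> - \<alpha>)"
    proof (rule dense_le_bounded)
      show "a k < a (Suc k)" by (rule a_less[OF k])
      fix v assume v: "a k < v" "v < a (Suc k)"
      then obtain y where y: "y \<in> {\<alpha>'..<\<beta>'}" "?h y = v" using ex[of v] by (auto simp: pint_def)
      have xy: "x \<in> {\<alpha>..<\<beta>}" "y \<in> {\<alpha>..<\<beta>}" using x y C'eq by blast+
      then have "x < y" using strict_mono_on_less[OF S(1) xy] x(2) y(2) v by simp
      then have "(v - a k) * (\<beta> - \<alpha>) \<le> K * (y - x)"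
        using dist[OF w C(1), of x y] xy x(2) y(2) by auto
      also have "\<dots> \<le> K * (\<beta>' - \<alpha>')" using K x(1) y(1) by (intro mult_left_mono) auto
      finally show "v \<le> a k + K * (\<beta>' - \<alpha>') / (\<beta> - \<alpha>)" using C(2) by (simp add: field_simps)
    qed
    then have "(a (Suc k) - a k) * (\<beta> - \<alpha>) \<le> K * (\<beta>' - \<alpha>')" using C(2) by (simp add: field_simps)
    moreover have "\<rho> * (\<beta> - \<alpha>) \<le> (a (Suc k) - a k) * (\<beta> - \<alpha>)"
      using \<rho>(2)[OF k] C(2) by (intro mult_right_mono) auto
    ultimately show "\<rho> / K * (\<beta> - \<alpha>) \<le> \<beta>' - \<alpha>'" using K by (simp add: field_simps)
  qed
qed

section \<open>Codes and cylinders\<close>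

lemma code_less: "x \<in> {0..<1} \<Longrightarrow> code f a g x j < g"
  unfolding code_def by (intro digit_less funpow_unit)

lemma code_word: "x \<in> {0..<1} \<Longrightarrow> map (code f a g x) [0..<n] \<in> words g n"
  using code_less by (auto simp: words_def)

lemma code_cyl: "x \<in> {0..<1} \<Longrightarrow> x \<in> cyl f a g (map (code f a g x) [0..<n])"
  using pint_digit[OF funpow_unit] by (simp add: cyl_def code_def)

lemma cyl_code:
  assumes "v \<in> words g n" "x \<in> cyl f a g v" "j < n"
  shows "code f a g x j = v ! j"
proof -
  have "v ! j < g" using assms(1,3) nth_mem[of j v] by (force simp: words_def)
  then show ?thesis using assms unfolding code_def by (intro digit_eq) (auto simp: cyl_def words_def)
qed

text \<open>The cylinders around the midpoint shrink to it. The first one shorter than half the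
  interval fits inside, and its parent is still at least that long, so
  \<open>cyl_child_ratio\<close> bounds it from below.\<close>

lemma cyl_in_interval:
  obtains c where "0 < c"
    "\<And>u v. 0 \<le> u \<Longrightarrow> u < v \<Longrightarrow> v \<le> 1 \<Longrightarrow> \<exists>n w \<alpha> \<beta>. w \<in> words g n \<and> cyl f a g w = {\<alpha>..<\<beta>} \<and> \<alpha> < \<beta> \<and>
       {\<alpha>..<\<beta>} \<subseteq> {u..<v} \<and> c * (v - u) \<le> \<beta> - \<alpha>"
proof -
  obtain \<kappa> where \<kappa>: "0 < \<kappa>" and ratio:
    "\<And>n w k \<alpha> \<beta> \<alpha>' \<beta>'. w \<in> words g n \<Longrightarrow> k < g \<Longrightarrow> cyl f a g w = {\<alpha>..<\<beta>} \<Longrightarrow> \<alpha> < \<beta> \<Longrightarrow>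
       cyl f a g (w @ [k]) = {\<alpha>'..<\<beta>'} \<Longrightarrow> \<alpha>' < \<beta>' \<Longrightarrow> \<kappa> * (\<beta> - \<alpha>) \<le> \<beta>' - \<alpha>'"
    using cyl_child_ratio by blast
  show thesis
  proof
    show "0 < \<kappa> / 2" using \<kappa> by simp
    fix u v :: real assume uv: "0 \<le> u" "u < v" "v \<le> 1"
    define x where "x = (u + v) / 2"
    have x: "x \<in> {0..<1}" using uv by (auto simp: x_def)
    define W where "W n = map (code f a g x) [0..<n]" for n
    have W: "W n \<in> words g n" "x \<in> cyl f a g (W n)" "W (Suc n) = W n @ [code f a g x n]" for n
      using code_word[OF x] code_cyl[OF x] by (auto simp: W_def)
    have "\<exists>\<alpha> \<beta>. \<alpha> < \<beta> \<and> cyl f a g (W n) = {\<alpha>..<\<beta>}" for n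
      using cyl_interval[OF W(1)[of n]] by blast
    then obtain \<alpha> \<beta> where ab: "\<And>n. \<alpha> n < \<beta> n" "\<And>n. cyl f a g (W n) = {\<alpha> n..<\<beta> n}" by metis
    have diam: "diameter (cyl f a g (W n)) = \<beta> n - \<alpha> n" for n
    proof -
      have "diameter {\<alpha> n..<\<beta> n} = diameter (closure {\<alpha> n..<\<beta> n})"
        by (rule diameter_closure[symmetric]) simp
      then show ?thesis using ab(1)[of n] by (simp add: ab(2) closure_atLeastLessThan)
    qed
    have "(\<lambda>n. diameter (cyl f a g (W n))) \<longlonglongrightarrow> 0"
      using setting code_less[OF x] unfolding setting_def W_def by blast
    then have "\<forall>\<^sub>F n in sequentially. \<beta> n - \<alpha> n < (v - u) / 2"
      unfolding diam using uv by (intro order_tendstoD(2)[of _ 0]) auto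
    then have ex: "\<exists>n. \<beta> n - \<alpha> n < (v - u) / 2" by (auto dest: eventually_happens'[rotated])
    define n where "n = (LEAST n. \<beta> n - \<alpha> n < (v - u) / 2)"
    have n: "\<beta> n - \<alpha> n < (v - u) / 2" unfolding n_def using ex by (rule LeastI_ex)
    \<comment> \<open>The cylinder of generation 0 has length 1, too long to qualify, so a parent
      exists.\<close>
    have "n \<noteq> 0"
    proof
      assume "n = 0"
      moreover have "{\<alpha> 0..<\<beta> 0} = {0..<1}" unfolding ab(2)[symmetric] by (auto simp: W_def cyl_def)
      then have "\<alpha> 0 = 0" "\<beta> 0 = 1" using ab(1)[of 0] by (simp_all add: Ico_eq_Ico)
      ultimately show False using n uv by simp
    qed
    then obtain m where m: "n = Suc m" by (cases n) auto
    have "\<not> \<beta> m - \<alpha> m < (v - u) / 2" 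
      using not_less_Least[of m "\<lambda>n. \<beta> n - \<alpha> n < (v - u) / 2"] m unfolding n_def by simp
    moreover have "\<kappa> * (\<beta> m - \<alpha> m) \<le> \<beta> n - \<alpha> n"
      using ratio[OF W(1)[of m] code_less[OF x] ab(2,1)[of m], of m "\<alpha> n" "\<beta> n"] ab[of n]
      by (simp add: m W(3))
    moreover have "\<kappa> * ((v - u) / 2) \<le> \<kappa> * (\<beta> m - \<alpha> m)"
      using \<kappa> calculation(1) by (intro mult_left_mono) auto
    ultimately have "\<kappa> / 2 * (v - u) \<le> \<beta> n - \<alpha> n" by simp
    moreover have "{\<alpha> n..<\<beta> n} \<subseteq> {u..<v}"
      using W(2)[of n] n unfolding ab(2) x_def by (auto simp: field_simps)
    ultimately show "\<exists>n w \<alpha> \<beta>. w \<in> words g n \<and> cyl f a g w = {\<alpha>..<\<beta>} \<and> \<alpha> < \<beta> \<and>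
       {\<alpha>..<\<beta>} \<subseteq> {u..<v} \<and> \<kappa> / 2 * (v - u) \<le> \<beta> - \<alpha>"
      by (intro exI[of _ n] exI[of _ "W n"] exI[of _ "\<alpha> n"] exI[of _ "\<beta> n"]) (simp add: W(1) ab)
  qed
qed

section \<open>Frequencies\<close>

text \<open>All windows counted up to \<open>n\<close> lie within the first \<open>n\<close> digits,
  which are constant on the cylinder.\<close>

lemma freq_cong:
  assumes "v \<in> words g n" "x \<in> cyl f a g v" "y \<in> cyl f a g v"
  shows "freq f a g w x n = freq f a g w y n"
proof -
  have eq: "map (\<lambda>t. code f a g x (j + t)) [0..<length w] = map (\<lambda>t. code f a g y (j + t)) [0..<length w]"
    if "j < n - length w" for j
    using cyl_code[OF assms(1,2)] cyl_code[OF assms(1,3)] that by auto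
  then have "tau f a g w x n = tau f a g w y n"
    unfolding tau_def
    by (intro arg_cong[of _ _ card] Collect_cong conj_cong refl) (simp only: eq atLeastLessThan_iff)
  then show ?thesis by (simp add: freq_def)
qed

lemma code_funpow: "code f a g ((f ^^ k) x) j = code f a g x (k + j)"
  by (simp add: code_def funpow_add add.commute)

text \<open>The windows of \<open>x\<close> starting at position k or later are the windows of the
  shifted point. At most k others are added, and the denominator also grows by k.\<close>

lemma freq_funpow:
  assumes n: "length w < n"
  shows "\<bar>freq f a g w x (k + n) - freq f a g w ((f ^^ k) x) n\<bar> \<le> real k / real (n - length w)"
proof -
  define d where "d = n - length w"
  have d: "0 < d" and kd: "k + n - length w = k + d" using n by (auto simp: d_def)
  define M where "M j \<longleftrightarrow> map (\<lambda>t. code f a g x (j + t)) [0..<length w] = w" for j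
  have y: "tau f a g w ((f ^^ k) x) n = card {j \<in> {0..<d}. M (k + j)}"
    unfolding tau_def M_def d_def code_funpow by (simp add: add.assoc)
  have x: "tau f a g w x (k + n) = card {j \<in> {0..<k + d}. M j}"
    unfolding tau_def M_def kd ..
  have "card {j \<in> {0..<d}. M (k + j)} = card ((+) k ` {j \<in> {0..<d}. M (k + j)})"
    by (rule card_image[symmetric]) simp
  also have "\<dots> \<le> card {j \<in> {0..<k + d}. M j}" by (rule card_mono) auto
  finally have le1: "card {j \<in> {0..<d}. M (k + j)} \<le> card {j \<in> {0..<k + d}. M j}" .
  have "{j \<in> {0..<k + d}. M j} \<subseteq> {0..<k} \<union> (+) k ` {j \<in> {0..<d}. M (k + j)}"
  proof
    fix j assume j: "j \<in> {j \<in> {0..<k + d}. M j}"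
    show "j \<in> {0..<k} \<union> (+) k ` {j \<in> {0..<d}. M (k + j)}"
    proof (cases "j < k")
      case False
      then have "j = k + (j - k)" by simp
      then show ?thesis using j False by (intro UnI2 image_eqI[of _ _ "j - k"]) auto
    qed simp
  qed
  then have "card {j \<in> {0..<k + d}. M j} \<le> card ({0..<k} \<union> (+) k ` {j \<in> {0..<d}. M (k + j)})"
    by (rule card_mono[rotated]) simp
  also have "\<dots> \<le> k + card {j \<in> {0..<d}. M (k + j)}"
    using card_Un_le[of "{0..<k}" "(+) k ` {j \<in> {0..<d}. M (k + j)}"] by (simp add: card_image)
  finally have le2: "card {j \<in> {0..<k + d}. M j} \<le> k + card {j \<in> {0..<d}. M (k + j)}" .
  have "card {j \<in> {0..<d}. M (k + j)} \<le> card {0..<d}" by (rule card_mono) auto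
  then have le3: "card {j \<in> {0..<d}. M (k + j)} \<le> d" by simp
  define p where "p = real (card {j \<in> {0..<d}. M (k + j)})"
  define q where "q = real (card {j \<in> {0..<k + d}. M j})"
  have pq: "0 \<le> p" "p \<le> q" "q \<le> k + p" "p \<le> d" using le1 le2 le3 by (auto simp: p_def q_def)
  have "p / real d - q / (real k + real d) \<le> real k / real d"
  proof -
    have "p / real d - q / (real k + real d) \<le> p / real d - p / (real k + real d)"
      using pq d by (intro diff_left_mono divide_right_mono) auto
    also have "\<dots> = p * real k / (real d * (real k + real d))" using d by (simp add: field_simps)
    also have "\<dots> \<le> (real k + real d) * real k / (real d * (real k + real d))" using pq d by (intro divide_right_mono mult_right_mono) auto
    also have "\<dots> = real k / real d"
    proof -
      have "real k + real d \<noteq> 0" using d by simp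
      then show ?thesis by (metis mult.commute nonzero_mult_divide_mult_cancel_left)
    qed
    finally show ?thesis .
  qed
  moreover have "q / (real k + real d) - p / real d \<le> real k / real d"
  proof -
    have "q / (real k + real d) \<le> q / real d" using pq d by (intro divide_left_mono) auto
    also have "\<dots> \<le> (real k + p) / real d" using pq by (intro divide_right_mono) auto
    finally show ?thesis by (simp add: add_divide_distrib)
  qed
  ultimately show ?thesis
    unfolding freq_def x y kd p_def[symmetric] q_def[symmetric] by (simp add: d_def[symmetric] abs_le_iff)
qed

lemma finite_words: "finite (words g n)"
  unfolding words_def by (rule finite_lists_length_eq) simp

text \<open>Inside J a cylinder of comparable length is chosen, and the set \<open>V n\<close> of
  points with nearly correct frequency is pulled back to it by \<open>f ^^ \<nu>\<close>. The
  Lipschitz bound for \<open>f ^^ \<nu>\<close> keeps the content of the pullback above a constant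
  times |J|^t.\<close>

lemma ubiquitous_freq:
  assumes t: "0 < t" and E: "0 < hausdorff_content t {x \<in> {0..<1}. freq f a g w x \<longlonglongrightarrow> r}" and \<epsilon>: "0 < \<epsilon>"
  shows "ubiquitous t {x \<in> {0..<1}. \<exists>n\<ge>N. \<bar>freq f a g w x n - r\<bar> < \<epsilon>}" (is "ubiquitous t ?U")
proof -
  \<comment> \<open>Half of \<epsilon> is reserved for the change of frequency caused by the first
    \<open>\<nu>\<close> digits.\<close>
  define V where "V n = {x \<in> {0..<1}. \<bar>freq f a g w x n - r\<bar> < \<epsilon> / 2}" for n
  have "{x \<in> {0..<1}. freq f a g w x \<longlonglongrightarrow> r} \<subseteq> (\<Union>N0. \<Inter>n\<in>{N0..}. V n)"
  proof
    fix x assume "x \<in> {x \<in> {0..<1}. freq f a g w x \<longlonglongrightarrow> r}"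
    then have x: "x \<in> {0..<1}" "freq f a g w x \<longlonglongrightarrow> r" by auto
    then obtain N0 where "\<forall>n\<ge>N0. norm (freq f a g w x n - r) < \<epsilon> / 2"
      using LIMSEQ_D[OF x(2), of "\<epsilon> / 2"] \<epsilon> by auto
    then show "x \<in> (\<Union>N0. \<Inter>n\<in>{N0..}. V n)" using x(1) by (auto simp: V_def)
  qed
  from less_le_trans[OF E hausdorff_content_mono[OF this]]
  obtain N0 where "0 < hausdorff_content t (\<Inter>n\<in>{N0..}. V n)" by (rule hausdorff_content_pos_UN_nat)
  \<comment> \<open>The content may be infinite, so a finite positive lower bound is picked. It
    comes from the tail intersection and therefore holds for all \<open>V n\<close> with
    \<open>n \<ge> N0\<close>, which matters because \<open>n\<close> will depend on J.\<close>
  then obtain y where y: "0 < y" "y < hausdorff_content t (\<Inter>n\<in>{N0..}. V n)" using dense by blast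
  then have "y < top" using less_le_trans top_greatest by blast
  define c0 where "c0 = enn2real y"
  have c0: "0 < c0" "ennreal c0 \<le> hausdorff_content t (\<Inter>n\<in>{N0..}. V n)"
    using y \<open>y < top\<close> by (auto simp: c0_def enn2real_positive_iff)
  have V: "ennreal c0 \<le> hausdorff_content t (V n)" if "N0 \<le> n" for n
    by (rule order_trans[OF c0(2) hausdorff_content_mono]) (use that in auto)
  obtain K where K: "0 < K" and dist: "\<And>n w \<alpha> \<beta> x y. w \<in> words g n \<Longrightarrow> cyl f a g w = {\<alpha>..<\<beta>} \<Longrightarrow>
      \<alpha> \<le> x \<Longrightarrow> x \<le> y \<Longrightarrow> y < \<beta> \<Longrightarrow> ((f ^^ n) y - (f ^^ n) x) * (\<beta> - \<alpha>) \<le> K * (y - x)"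
    using bounded_distortion by blast
  obtain c1 where c1: "0 < c1" and inner: "\<And>u v. 0 \<le> u \<Longrightarrow> u < v \<Longrightarrow> v \<le> 1 \<Longrightarrow>
      \<exists>n w \<alpha> \<beta>. w \<in> words g n \<and> cyl f a g w = {\<alpha>..<\<beta>} \<and> \<alpha> < \<beta> \<and>
       {\<alpha>..<\<beta>} \<subseteq> {u..<v} \<and> c1 * (v - u) \<le> \<beta> - \<alpha>"
    using cyl_in_interval by blast
  \<comment> \<open>\<open>c1\<close> compares the cylinder with J, \<open>K\<close> is the
    distortion, and the factor 1/2 is lost in \<open>dyadic_inner_approximation\<close>.\<close>
  define c where "c = c0 * (c1 / K) powr t / 2"
  have c: "0 < c" using c0 c1 K by (simp add: c_def)
  show ?thesis
    unfolding ubiquitous_def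
  proof (intro exI[of _ c] conjI allI impI)
    show "0 < c" by fact
    fix lev k :: nat assume k: "k < 2 ^ lev"
    define u v where "u = real k / 2 ^ lev" and "v = (real k + 1) / 2 ^ lev"
    have J: "dyadic (lev, k) = {u..<v}" by (simp add: dyadic_def u_def v_def)
    have uv: "0 \<le> u" "u < v" "v - u = 1 / 2 ^ lev"
      by (auto simp: u_def v_def divide_strict_right_mono add_divide_distrib)
    have "real k + 1 \<le> 2 ^ lev" using k of_nat_mono[of "Suc k" "2 ^ lev", where 'a = real] by simp
    then have "v \<le> 1" by (simp add: v_def)
    from inner[OF uv(1,2) this] obtain \<nu> z \<alpha> \<beta> where z: "z \<in> words g \<nu>" "cyl f a g z = {\<alpha>..<\<beta>}"
      "\<alpha> < \<beta>" "{\<alpha>..<\<beta>} \<subseteq> {u..<v}" "c1 * (v - u) \<le> \<beta> - \<alpha>" by blast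
    let ?h = "f ^^ \<nu>"
    have h: "strict_mono_on {\<alpha>..<\<beta>} ?h" "?h ` {\<alpha>..<\<beta>} = {0..<1}"
      using cyl_interval[OF z(1)] z(2) by auto
    obtain n0 :: nat where n0: "real \<nu> / (\<epsilon> / 2) < n0" using reals_Archimedean2 by blast
    \<comment> \<open>The terms ensure, in turn, the content bound, the index condition
      \<open>n \<ge> N\<close>, a shift error below \<epsilon>/2, and a positive
      denominator.\<close>
    define n where "n = N0 + N + n0 + 1 + length w"
    have n: "N0 \<le> n" "N \<le> n" "length w < n" "n0 \<le> n - length w" by (auto simp: n_def)
    have err: "real \<nu> / real (n - length w) < \<epsilon> / 2"
    proof -
      have "real \<nu> / (\<epsilon> / 2) < real (n - length w)" using n0 n(4) by linarith
      then show ?thesis using \<epsilon> n(3) by (simp add: field_simps)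
    qed
    define W where "W = {x \<in> {\<alpha>..<\<beta>}. ?h x \<in> V n}"
    have cyl01: "cyl f a g u \<subseteq> {0..<1}" for u by (auto simp: cyl_def)
    have WU: "W \<subseteq> ?U"
    proof
      fix x assume x: "x \<in> W"
      have "\<bar>freq f a g w x (\<nu> + n) - r\<bar> < \<epsilon>"
      proof -
        have "\<bar>freq f a g w (?h x) n - r\<bar> < \<epsilon> / 2" using x by (simp add: W_def V_def)
        moreover have "\<bar>freq f a g w x (\<nu> + n) - freq f a g w (?h x) n\<bar> < \<epsilon> / 2"
          using freq_funpow[OF n(3)] err by (rule le_less_trans)
        ultimately show ?thesis by linarith
      qed
      moreover have "x \<in> {0..<1}" using x cyl01[of z] z(2) by (auto simp: W_def)
      ultimately show "x \<in> ?U" using n(2) by (auto intro!: exI[of _ "\<nu> + n"])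
    qed
    have "ennreal (2 * (c * weight t (lev, k))) \<le> hausdorff_content t W"
    proof -
      define L where "L = K / (\<beta> - \<alpha>)"
      have L: "0 < L" using K z(3) by (simp add: L_def)
      have lip: "dist (?h x) (?h y) \<le> L * dist x y" if "x \<in> W" "y \<in> W" for x y
      proof -
        have *: "dist (?h x) (?h y) \<le> L * dist x y"
          if xy: "x \<in> {\<alpha>..<\<beta>}" "y \<in> {\<alpha>..<\<beta>}" "x \<le> y" for x y
        proof -
          have "?h x \<le> ?h y" using strict_mono_on_less_eq[OF h(1) xy(1,2)] xy(3) by simp
          moreover have "(?h y - ?h x) * (\<beta> - \<alpha>) \<le> K * (y - x)"
            using dist[OF z(1,2), of x y] xy by auto
          ultimately show ?thesis using xy(3) z(3) by (simp add: dist_real_def L_def field_simps)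
        qed
        show ?thesis
          using *[of x y] *[of y x] that by (cases "x \<le> y") (auto simp: W_def dist_commute)
      qed
      have "V n = ?h ` W"
      proof
        show "V n \<subseteq> ?h ` W"
        proof
          fix y assume y: "y \<in> V n"
          then have "y \<in> ?h ` {\<alpha>..<\<beta>}" unfolding h(2) by (simp add: V_def)
          then show "y \<in> ?h ` W" using y by (auto simp: W_def)
        qed
      qed (auto simp: W_def)
      then have *: "ennreal c0 \<le> ennreal (L powr t) * hausdorff_content t W"
        using V[OF n(1)] hausdorff_content_lipschitz_image[OF t L lip] by (metis order_trans)
      have "ennreal (c0 / L powr t) \<le> hausdorff_content t W"
      proof -
        have "ennreal c0 / ennreal (L powr t) \<le> hausdorff_content t W"
          using * L by (intro divide_le_posI_ennreal) auto
        then show ?thesis using c0(1) L by (simp add: divide_ennreal)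
      qed
      moreover have "2 * (c * weight t (lev, k)) \<le> c0 / L powr t"
      proof -
        have "2 * (c * weight t (lev, k)) = c0 * (c1 / K * (v - u)) powr t"
          unfolding c_def uv(3) weight_def using c1 K powr_mult[of "c1 / K" "1 / 2 ^ lev" t] by simp
        also have "\<dots> \<le> c0 * ((\<beta> - \<alpha>) / K) powr t"
          using divide_right_mono[OF z(5), of K] c0 c1 K t uv(2) by (intro mult_left_mono powr_mono2) auto
        also have "(\<beta> - \<alpha>) / K = 1 / L" by (simp add: L_def)
        also have "c0 * (1 / L) powr t = c0 / L powr t" using L by (simp add: powr_divide)
        finally show ?thesis .
      qed
      ultimately show ?thesis by (meson ennreal_leI order_trans)
    qed
    \<comment> \<open>Membership in \<open>W\<close> depends only on the first
      \<open>\<nu> + n\<close> digits: the first \<open>\<nu>\<close> place the point in the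
      cylinder of \<open>z\<close>, the next \<open>n\<close> determine the frequency of its image.
      So \<open>W\<close> is a finite union of cylinders, hence of half-open intervals.\<close>
    moreover have "\<exists>\<alpha>' \<beta>'. W = (\<Union>q\<in>{q \<in> words g (\<nu> + n). cyl f a g q \<subseteq> W}. {\<alpha>' q..<\<beta>' q})"
    proof -
      have "\<forall>q\<in>words g (\<nu> + n). \<exists>\<alpha> \<beta>. cyl f a g q = {\<alpha>..<\<beta>}" using cyl_interval by blast
      then obtain \<alpha>' \<beta>' where q: "\<And>q. q \<in> words g (\<nu> + n) \<Longrightarrow> cyl f a g q = {\<alpha>' q..<\<beta>' q}"
        by metis
      have "W = (\<Union>q\<in>{q \<in> words g (\<nu> + n). cyl f a g q \<subseteq> W}. cyl f a g q)"
      proof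
        show "W \<subseteq> (\<Union>q\<in>{q \<in> words g (\<nu> + n). cyl f a g q \<subseteq> W}. cyl f a g q)"
        proof
          fix x assume x: "x \<in> W"
          then have x01: "x \<in> {0..<1}" using cyl01[of z] z(2) by (auto simp: W_def)
          define q where "q = map (code f a g x) [0..<\<nu> + n]"
          have q: "q \<in> words g (\<nu> + n)" "x \<in> cyl f a g q"
            unfolding q_def using x01 by (rule code_word, rule code_cyl)
          have "y \<in> W" if y: "y \<in> cyl f a g q" for y
          proof -
            have y01: "y \<in> {0..<1}" using y cyl01 by blast
            have same: "(f ^^ i) y \<in> pint a (code f a g x i)" if "i < \<nu> + n" for i
              using y that by (auto simp: cyl_def q_def)
            have zc: "z ! i = code f a g x i" if "i < \<nu>" for i
              using cyl_code[OF z(1), of x i] x that unfolding W_def z(2) by auto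
            have "y \<in> cyl f a g z"
              using z(1) y01 same zc by (auto simp: cyl_def words_def)
            then have "y \<in> {\<alpha>..<\<beta>}" by (simp add: z(2))
            moreover have "?h y \<in> V n"
            proof -
              define q' where "q' = map (code f a g (?h x)) [0..<n]"
              have "?h x \<in> {0..<1}" "?h y \<in> {0..<1}" using funpow_unit x01 y01 by blast+
              then have q': "q' \<in> words g n" "?h x \<in> cyl f a g q'"
                unfolding q'_def by (auto intro: code_word code_cyl simp del: atLeastLessThan_iff)
              have "?h y \<in> cyl f a g q'"
                using same[of "\<nu> + i" for i] \<open>?h y \<in> {0..<1}\<close>
                by (auto simp: cyl_def q'_def code_funpow funpow_add add.commute)
              from freq_cong[OF q'(1) this q'(2)] show ?thesis
                using x \<open>?h y \<in> {0..<1}\<close> by (simp add: W_def V_def)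
            qed
            ultimately show ?thesis by (simp add: W_def)
          qed
          then show "x \<in> (\<Union>q\<in>{q \<in> words g (\<nu> + n). cyl f a g q \<subseteq> W}. cyl f a g q)"
            using q by blast
        qed
      qed auto
      also have "\<dots> = (\<Union>q\<in>{q \<in> words g (\<nu> + n). cyl f a g q \<subseteq> W}. {\<alpha>' q..<\<beta>' q})"
        using q by (intro SUP_cong) auto
      finally show ?thesis by blast
    qed
    then obtain \<alpha>' \<beta>' where "W = (\<Union>q\<in>{q \<in> words g (\<nu> + n). cyl f a g q \<subseteq> W}. {\<alpha>' q..<\<beta>' q})" by blast
    moreover have "finite {q \<in> words g (\<nu> + n). cyl f a g q \<subseteq> W}" using finite_words by simp
    moreover have "W \<subseteq> {0..<1}" using WU by blast
    moreover have "0 < c * weight t (lev, k)" using c by (simp add: weight_def)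
    ultimately have "\<forall>\<^sub>F m in sequentially. \<exists>S\<subseteq>{..<2 ^ m}. (\<forall>l\<in>S. closure (dyadic (m, l)) \<subseteq> W) \<and>
        dyadic_union m S \<subseteq> W \<and> dyadic_content_ge t (c * weight t (lev, k)) (dyadic_union m S)"
      using t by (intro dyadic_inner_approximation) auto
    moreover have "W \<subseteq> dyadic (lev, k)" unfolding J using z(4) by (auto simp: W_def)
    ultimately show "\<forall>\<^sub>F m in sequentially. \<exists>S\<subseteq>{..<2 ^ m}. (\<forall>l\<in>S. closure (dyadic (m, l)) \<subseteq> ?U) \<and>
        dyadic_union m S \<subseteq> dyadic (lev, k) \<and> dyadic_content_ge t (c * weight t (lev, k)) (dyadic_union m S)"
      using WU by (elim eventually_mono) (meson order_trans)
  qed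
qed

end

section \<open>Points without frequencies\<close>

lemma not_convergentI:
  fixes u :: "nat \<Rightarrow> real"
  assumes "p \<noteq> q"
    and p: "\<And>e N. \<exists>n\<ge>N. \<bar>u n - p\<bar> < 1 / real (Suc e)"
    and q: "\<And>e N. \<exists>n\<ge>N. \<bar>u n - q\<bar> < 1 / real (Suc e)"
  shows "\<not> convergent u"
proof
  assume "convergent u"
  then obtain L where L: "u \<longlonglongrightarrow> L" by (auto simp: convergent_def)
  have "L = r" if r: "\<And>e N. \<exists>n\<ge>N. \<bar>u n - r\<bar> < 1 / real (Suc e)" for r
  proof (rule ccontr)
    assume "L \<noteq> r"
    then have d: "0 < \<bar>L - r\<bar> / 2" by simp
    obtain N where N: "\<And>n. n \<ge> N \<Longrightarrow> \<bar>u n - L\<bar> < \<bar>L - r\<bar> / 2"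
      using LIMSEQ_D[OF L d] by auto
    obtain e where e: "1 / real (Suc e) < \<bar>L - r\<bar> / 2"
      using reals_Archimedean[OF d] by (auto simp: inverse_eq_divide)
    obtain n where "n \<ge> N" "\<bar>u n - r\<bar> < 1 / real (Suc e)" using r by blast
    then have "\<bar>u n - r\<bar> < \<bar>L - r\<bar> / 2" "\<bar>u n - L\<bar> < \<bar>L - r\<bar> / 2" using N e by auto
    moreover have "\<bar>L - r\<bar> \<le> \<bar>u n - r\<bar> + \<bar>u n - L\<bar>" by simp
    ultimately show False by simp
  qed
  from this[OF p] this[OF q] show False using \<open>p \<noteq> q\<close> by simp
qed

theorem mainTheorem2:
  fixes F :: "nat \<Rightarrow> real \<Rightarrow> real" and A :: "nat \<Rightarrow> nat \<Rightarrow> real" and G :: "nat \<Rightarrow> nat"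
  assumes "\<And>i. setting (F i) (A i) (G i)"
    and "\<And>i. cond_i (F i) (A i) (G i)"
    and "\<And>i. cond_ii (F i) (A i) (G i)"
  shows "hausdorff_dim {x \<in> {0..<1}. \<forall>i. \<forall>m \<ge> 1. \<forall>w \<in> words (G i) m.
            \<not> convergent (freq (F i) (A i) (G i) w x)} = 1"
proof -
  define T where "T = {x \<in> {0..<1}. \<forall>i. \<forall>m \<ge> 1. \<forall>w \<in> words (G i) m.
            \<not> convergent (freq (F i) (A i) (G i) w x)}"
  have lower: "hausdorff_measure s T \<noteq> 0" if s: "0 < s" "s < 1" for s
  proof -
    \<comment> \<open>Any t strictly between s and 1 would do: it must lie below the available
      dimensions and leave a gap above s for the decreasing exponents.\<close>
    define t where "t = (s + 1) / 2"
    have t: "0 < t" "s < t" "t < 1" using s by (auto simp: t_def)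
    define P where "P i w p q \<longleftrightarrow> p \<noteq> q \<and> (\<forall>r\<in>{p, q}.
        0 < hausdorff_content t {x \<in> {0..<1}. freq (F i) (A i) (G i) w x \<longlonglongrightarrow> r})" for i w p q
    have "\<exists>p q. P i w p q"
      if w: "w \<in> words (G i) (length w)" "w \<noteq> []" for i w
    proof -
      have "1 \<le> length w" using w(2) by (cases w) auto
      \<comment> \<open>Condition (ii) with \<delta> = 1 - t makes the dimension of the second set
        exceed t; the first has dimension 1 > t.\<close>
      with assms(3)[of i] w(1) obtain p q where p: "hausdorff_dim (Gset (F i) (A i) (G i) (length w) p) = 1"
        and q: "q w \<noteq> p w" "1 - (1 - t) < hausdorff_dim (Gset (F i) (A i) (G i) (length w) q)"
        unfolding cond_ii_def using t by (metis diff_gt_0_iff_gt)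
      have pos: "0 < hausdorff_content t {x \<in> {0..<1}. freq (F i) (A i) (G i) w x \<longlonglongrightarrow> r w}"
        if "t < hausdorff_dim (Gset (F i) (A i) (G i) (length w) r)" for r
        using hausdorff_content_pos_of_dim[OF t(1) that]
        by (rule less_le_trans[OF _ hausdorff_content_mono]) (use w(1) in \<open>auto simp: Gset_def\<close>)
      show ?thesis
        unfolding P_def using pos[of p] pos[of q] p q t by (intro exI[of _ "p w"] exI[of _ "q w"]) auto
    qed
    then have "\<forall>i w. \<exists>p q. w \<in> words (G i) (length w) \<longrightarrow> w \<noteq> [] \<longrightarrow> P i w p q" by blast
    then obtain p q where "\<And>i w. w \<in> words (G i) (length w) \<Longrightarrow> w \<noteq> [] \<Longrightarrow> P i w (p i w) (q i w)"
      unfolding choice_iff by blast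
    then have pq: "\<And>i w. w \<in> words (G i) (length w) \<Longrightarrow> w \<noteq> [] \<Longrightarrow> p i w \<noteq> q i w"
      "\<And>i w r. w \<in> words (G i) (length w) \<Longrightarrow> w \<noteq> [] \<Longrightarrow> r \<in> {p i w, q i w} \<Longrightarrow>
        0 < hausdorff_content t {x \<in> {0..<1}. freq (F i) (A i) (G i) w x \<longlonglongrightarrow> r}"
      unfolding P_def by blast+
    \<comment> \<open>A countable index set: map, word, which of the two values is approached
      (\<open>b\<close>), precision 1/(e+1), and the index \<open>N\<close> beyond which the
      approach occurs.\<close>
    define I :: "(nat \<times> nat list \<times> bool \<times> nat \<times> nat) set"
      where "I = {(i, w, b, e, N). w \<in> words (G i) (length w) \<and> w \<noteq> []}"
    define U where "U = (\<lambda>(i, w, b, e, N). {x \<in> {0..<1}.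
      \<exists>n\<ge>N. \<bar>freq (F i) (A i) (G i) w x n - (if b then p i w else q i w)\<bar> < 1 / real (Suc e)})"
    have ubiquitous: "ubiquitous t (U k)" if "k \<in> I" for k
    proof -
      obtain i w b e N where k: "k = (i, w, b, e, N)" by (cases k)
      interpret full_branch_map "F i" "A i" "G i"
        using assms(1,2) by unfold_locales
      show ?thesis
        unfolding k U_def case_prod_conv
        by (rule ubiquitous_freq[OF t(1) pq(2)]) (use that in \<open>auto simp: k I_def\<close>)
    qed
    have "0 < G 0" using assms(1)[of 0] by (simp add: setting_def)
    \<comment> \<open>A nonempty index set can be enumerated by \<open>from_nat_into\<close>; this
      same index later shows that points of the intersection lie in the unit interval.\<close>
    then have "(0, [0], True, 0, 0) \<in> I" by (simp add: I_def words_def)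
    then have ne: "I \<noteq> {}" by blast
    have "hausdorff_measure s (\<Inter>j. U (from_nat_into I j)) \<noteq> 0"
      using s(1) t by (intro hausdorff_measure_ubiquitous_INT[of s t] ubiquitous from_nat_into[OF ne]) auto
    moreover have "(\<Inter>j. U (from_nat_into I j)) = (\<Inter>k\<in>I. U k)"
      using range_from_nat_into[OF ne] by (metis (no_types) countableI_type image_image)
    moreover have "(\<Inter>k\<in>I. U k) \<subseteq> T"
    proof
      fix x assume x: "x \<in> (\<Inter>k\<in>I. U k)"
      then have "x \<in> U (0, [0], True, 0, 0)" using \<open>(0, [0], True, 0, 0) \<in> I\<close> by blast
      then have x01: "x \<in> {0..<1}" by (simp add: U_def)
      have "\<not> convergent (freq (F i) (A i) (G i) w x)" if m: "1 \<le> m" "w \<in> words (G i) m" for i m w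
      proof -
        have w: "w \<in> words (G i) (length w)" "w \<noteq> []" using m by (auto simp: words_def)
        have "x \<in> U (i, w, b, e, N)" for b e N using x w by (auto simp: I_def)
        then have "\<exists>n\<ge>N. \<bar>freq (F i) (A i) (G i) w x n - (if b then p i w else q i w)\<bar> < 1 / real (Suc e)"
          for b e N unfolding U_def by blast
        from this[where b = True] this[where b = False] show ?thesis
          by (intro not_convergentI[OF pq(1)[OF w]]) simp_all
      qed
      then show "x \<in> T" using x01 by (simp add: T_def)
    qed
    ultimately show ?thesis using hausdorff_measure_mono[of _ T s] by (metis le_zero_eq)
  qed
  \<comment> \<open>The measure vanishes for every exponent above 1 and for none in (0,1), so the
    infimum is 1.\<close>
  have "Inf {s. 0 < s \<and> hausdorff_measure s T = 0} = 1"
  proof (rule antisym)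
    show "Inf {s. 0 < s \<and> hausdorff_measure s T = 0} \<le> 1"
    proof (rule field_le_epsilon)
      fix e :: real assume "0 < e"
      then show "Inf {s. 0 < s \<and> hausdorff_measure s T = 0} \<le> 1 + e"
        by (intro cInf_lower bdd_belowI[of _ 0]) (auto intro: hausdorff_measure_unit_eq_0 simp: T_def)
    qed
    show "1 \<le> Inf {s. 0 < s \<and> hausdorff_measure s T = 0}"
    proof (rule cInf_greatest)
      have "hausdorff_measure 2 T = 0" by (rule hausdorff_measure_unit_eq_0) (auto simp: T_def)
      then show "{s. 0 < s \<and> hausdorff_measure s T = 0} \<noteq> {}" by (auto intro!: exI[of _ 2])
      show "1 \<le> s" if "s \<in> {s. 0 < s \<and> hausdorff_measure s T = 0}" for s
        using lower[of s] that by force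
    qed
  qed
  then show ?thesis unfolding hausdorff_dim_def T_def .
qed

end
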